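(* Let $a,b,c,d,e,m$ be nonnegative integers and let $\pi=\Lambda(a,b,c,d,e,m)=\lambda/b^a$ be the skew shape defined in the context, with $n=|\pi|$. Then the number of standard Young tableaux of shape $\pi$ is \[ f^{\pi}=n!\cdot\frac{\Phi(a+b+c)\,\Phi(a)\,\Phi(b)\,\Phi(c)}{\Phi(a+b)\,\Phi(b+c)\,\Phi(a+c)\,\Psi^{(m)}(a+c)\,\Psi^{(m)}(b+c)}\;\prod_{i=0}^{a+c-1}\frac{(i(m+1))!}{(d+i(m+1))!}\;\prod_{i=0}^{b+c-1}\frac{(i(m+1))!}{(e+i(m+1))!}\;\frac{\prod_{i=0}^{b-1}\prod_{j=0}^{a-1}\bigl(1+d+e+(c+i+j)(m+1)\bigr)}{\prod_{i=0}^{b+c-1}\prod_{j=0}^{a+c-1}\bigl(1+d+e+(i+j)(m+1)\bigr)}. \]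
   Context: Young diagrams are in English notation, cells $(i,j)$ with row $i$ and column $j$. For a skew shape $\lambda/\mu$, $f^{\lambda/\mu}$ is the number of standard Young tableaux of shape $\lambda/\mu$. Superfactorial: $\Phi(n)=\prod_{k=1}^{n-1}k!$ (so $\Phi(0)=\Phi(1)=1$). Falling factorial $(k)_m=k(k-1)\cdots(k-m+1)$, $(k)_0=1$, and $\Psi^{(m)}(n)=\prod_{i=1}^{n-1}\prod_{j=1}^{i}(jm+j-1)_m$. The shape $\Lambda(a,b,c,d,e,m)$: set $\nu_i=d+(a+c-i)m$ for $1\le i\le a+c$ and $\theta_j=e+(b+c-j)m$ for $1\le j\le b+c$; let $\lambda$ be the partition whose Young diagram consists of the cells $(i,j)$ with either ($i\le a+c$ and $j\le b+c+\nu_i$) or ($j\le b+c$ and $i\le a+c+\theta_j$) (i.e. the $(a+c)\times(b+c)$ rectangle with the rows of $\nu$ attached to its right and the columns of lengths $\theta_j$ attached below it); then $\Lambda(a,b,c,d,e,m)=\lambda/b^a$ where $b^a=(b,\dots,b)$ ($a$ parts). For example $\Lambda(a,b,c,d,e,0)=(b+c+d)^{a+c}(b+c)^e/b^a$ and $\Lambda(a,b,c,0,0,1)=\delta_{a+b+2c}/b^a$ with $\delta_N=(N-1,N-2,\dots,1)$. *)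

theory Defs
  imports Complex_Main "HOL-Library.FuncSet"
begin

text \<open>
  A cell is a pair \<open>(i, j)\<close> of a row index and a column index, both starting at 1 (English
  notation). A Young diagram, or a skew shape \<open>\<lambda>/\<mu>\<close>, is represented by its set of cells.
\<close>

type_synonym cell = "nat \<times> nat"

definition is_syt :: "cell set \<Rightarrow> (cell \<Rightarrow> nat) \<Rightarrow> bool" where
  "is_syt S T \<longleftrightarrow>
     bij_betw T S {1..card S} \<and>
     (\<forall>i j j'. (i, j) \<in> S \<longrightarrow> (i, j') \<in> S \<longrightarrow> j < j' \<longrightarrow> T (i, j) < T (i, j')) \<and>
     (\<forall>i i' j. (i, j) \<in> S \<longrightarrow> (i', j) \<in> S \<longrightarrow> i < i' \<longrightarrow> T (i, j) < T (i', j))"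

text \<open>
  Fillings are made \<^const>\<open>extensional\<close> so that each tableau is represented by exactly one
  function.
\<close>

definition num_syt :: "cell set \<Rightarrow> nat" where
  "num_syt S = card {T \<in> extensional S. is_syt S T}"

definition superfact :: "nat \<Rightarrow> nat" where
  "superfact n = (\<Prod>k\<in>{1..<n}. fact k)"

text \<open>
  The truncated subtraction is harmless: if \<open>k < m\<close>, the factor for \<open>i = k\<close> is zero.
\<close>

definition falling_fact :: "nat \<Rightarrow> nat \<Rightarrow> nat" where
  "falling_fact k m = (\<Prod>i<m. k - i)"

definition Psi :: "nat \<Rightarrow> nat \<Rightarrow> nat" where
  "Psi m n = (\<Prod>i\<in>{1..<n}. \<Prod>j\<in>{1..i}. falling_fact (j * m + j - 1) m)"

definition nu :: "nat \<Rightarrow> nat \<Rightarrow> nat \<Rightarrow> nat \<Rightarrow> nat \<Rightarrow> nat" where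
  "nu a c d m i = d + (a + c - i) * m"

definition theta :: "nat \<Rightarrow> nat \<Rightarrow> nat \<Rightarrow> nat \<Rightarrow> nat \<Rightarrow> nat" where
  "theta b c e m j = e + (b + c - j) * m"

definition outer_shape :: "nat \<Rightarrow> nat \<Rightarrow> nat \<Rightarrow> nat \<Rightarrow> nat \<Rightarrow> nat \<Rightarrow> cell set" where
  "outer_shape a b c d e m =
     {(i, j). 1 \<le> i \<and> 1 \<le> j \<and>
        (i \<le> a + c \<and> j \<le> b + c + nu a c d m i \<or>
         j \<le> b + c \<and> i \<le> a + c + theta b c e m j)}"

definition rect_shape :: "nat \<Rightarrow> nat \<Rightarrow> cell set" where
  "rect_shape a b = {1..a} \<times> {1..b}"

definition Lambda_shape :: "nat \<Rightarrow> nat \<Rightarrow> nat \<Rightarrow> nat \<Rightarrow> nat \<Rightarrow> nat \<Rightarrow> cell set" where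
  "Lambda_shape a b c d e m = outer_shape a b c d e m - rect_shape a b"

lemma outer_shape_down_closed:
  assumes "(i, j) \<in> outer_shape a b c d e m" "1 \<le> i'" "i' \<le> i" "1 \<le> j'" "j' \<le> j"
  shows "(i', j') \<in> outer_shape a b c d e m"
proof -
  have 1: "nu a c d m i \<le> nu a c d m i'" and 2: "theta b c e m j \<le> theta b c e m j'"
    using assms by (auto simp: nu_def theta_def intro!: mult_le_mono1 diff_le_mono2)
  show ?thesis using assms 1 2 unfolding outer_shape_def by auto
qed

lemma rect_shape_subset_outer_shape: "rect_shape a b \<subseteq> outer_shape a b c d e m"
  by (auto simp: rect_shape_def outer_shape_def)

lemma finite_outer_shape: "finite (outer_shape a b c d e m)"
proof (rule finite_subset)
  let ?N = "a + b + c + d + e + (a + b + c) * m"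
  have *: "(a + c - i) * m \<le> (a + b + c) * m" "(b + c - i) * m \<le> (a + b + c) * m" for i
    by (intro mult_le_mono1; simp)+
  show "outer_shape a b c d e m \<subseteq> {..?N} \<times> {..?N}"
  proof (clarsimp simp: outer_shape_def nu_def theta_def)
    fix i j
    assume "i \<le> a + c \<and> j \<le> b + c + (d + (a + c - i) * m) \<or>
            j \<le> b + c \<and> i \<le> a + c + (e + (b + c - j) * m)"
    then show "i \<le> ?N \<and> j \<le> ?N"
      using *(1)[of i] *(2)[of j] by linarith
  qed
qed simp

lemma Lambda_shape_m0:
  "Lambda_shape a b c d e 0 =
     (rect_shape (a + c) (b + c + d) \<union> rect_shape (a + c + e) (b + c)) - rect_shape a b"
  by (auto simp: Lambda_shape_def outer_shape_def rect_shape_def nu_def theta_def)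

lemma Lambda_shape_staircase:
  "Lambda_shape a b c 0 0 1 = {(i, j). 1 \<le> i \<and> 1 \<le> j \<and> i + j \<le> a + b + 2 * c} - rect_shape a b"
  by (auto simp: Lambda_shape_def outer_shape_def rect_shape_def nu_def theta_def)

end

theory Submission
  imports Defs "Jordan_Normal_Form.Determinant" "HOL-Computational_Algebra.Formal_Power_Series"
begin

text \<open>
  Removing the cell with the largest entry gives a recursion for the number of standard tableaux,
  and it is also satisfied by Aitken's determinant \<open>n! det (1 / (l\<^sub>i - m\<^sub>j)!)\<close>, where
  \<open>l\<^sub>i = \<lambda>\<^sub>i + N - i\<close> and \<open>m\<^sub>j = \<mu>\<^sub>j + N - j\<close>. Up to row factors its entries are falling
  factorials of the \<open>l\<^sub>i\<close>. With \<open>r = m + 1\<close>, the beta-numbers of the \<open>a + c\<close> long rows form a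
  progression \<open>x\<^sub>i\<close> of step \<open>r\<close>, and those of the other rows form the complement \<open>L\<close> of
  \<open>{0, r, \<dots>, (b + c - 1) r}\<close> in an initial segment of the naturals. Since \<open>\<mu>\<close> is a rectangle,
  the falling factorials can be replaced by Newton polynomials with nodes \<open>L\<close> followed by
  \<open>0, r, 2 r, \<dots>\<close>; the matrix becomes block triangular, and what remains is
  \<open>det (binomial (z + i) s\<^sub>j)\<close> with \<open>z = x\<^sub>0 / r\<close>, where the \<open>s\<^sub>j\<close> have a single gap. Row
  differences reduce it to the Toeplitz determinant \<open>det (binomial z (b + j - i))\<close>, a product.
\<close>

section \<open>Determinants of functions\<close>

text \<open>Index functions in place of matrices make shifted blocks and modified rows plain terms
  without dimension side conditions; only the values with both indices below \<open>n\<close>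
  matter.\<close>

definition fdet :: "nat \<Rightarrow> (nat \<Rightarrow> nat \<Rightarrow> 'a::idom) \<Rightarrow> 'a" where
  "fdet n f = det (mat n n (\<lambda>(i, j). f i j))"

lemma fdet_leibniz:
  "fdet n f = (\<Sum>p | p permutes {0..<n}. signof p * (\<Prod>i<n. f i (p i)))"
proof -
  have "(\<Prod>i = 0..<n. mat n n (\<lambda>(i, j). f i j) $$ (i, p i)) = (\<Prod>i<n. f i (p i))"
    if "p permutes {0..<n}" for p
    using permutes_in_image[OF that] by (auto simp: atLeast0LessThan intro!: prod.cong)
  then show ?thesis
    unfolding fdet_def by (subst det_def'[of _ n]) (auto intro!: sum.cong)
qed

lemma fdet_cong:
  assumes "\<And>i j. i < n \<Longrightarrow> j < n \<Longrightarrow> f i j = g i j"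
  shows "fdet n f = fdet n g"
  unfolding fdet_def by (rule arg_cong[of _ _ det]) (auto intro!: eq_matI simp: assms)

lemma fdet_transpose: "fdet n (\<lambda>i j. f j i) = fdet n f"
proof -
  have "mat n n (\<lambda>(i, j). f j i) = transpose_mat (mat n n (\<lambda>(i, j). f i j))"
    by (auto intro!: eq_matI)
  then show ?thesis
    unfolding fdet_def by (simp add: det_transpose[of _ n])
qed

lemma fdet_scale_rows: "fdet n (\<lambda>i j. u i * f i j) = (\<Prod>i<n. u i) * fdet n f"
  unfolding fdet_leibniz by (simp add: prod.distrib sum_distrib_left ac_simps)

lemma fdet_scale_cols: "fdet n (\<lambda>i j. u j * f i j) = (\<Prod>j<n. u j) * fdet n f"
  using fdet_scale_rows[of n u "\<lambda>i j. f j i"] fdet_transpose[of n "\<lambda>i j. u j * f i j"]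
    fdet_transpose[of n f] by simp

lemma fdet_lower_triangular:
  assumes "\<And>i j. i < j \<Longrightarrow> j < n \<Longrightarrow> f i j = 0"
  shows "fdet n f = (\<Prod>i<n. f i i)"
  unfolding fdet_def using assms
  by (subst det_lower_triangular[of n])
     (auto simp: prod_list_diag_prod atLeast0LessThan intro!: prod.cong)

lemma fdet_upper_triangular:
  assumes "\<And>i j. j < i \<Longrightarrow> i < n \<Longrightarrow> f i j = 0"
  shows "fdet n f = (\<Prod>i<n. f i i)"
  using fdet_lower_triangular[of n "\<lambda>i j. f j i"] assms fdet_transpose[of n f] by simp

lemma fdet_mult: "fdet n (\<lambda>i j. \<Sum>k<n. f i k * g k j) = fdet n f * fdet n g"
proof -
  have "mat n n (\<lambda>(i, j). \<Sum>k<n. f i k * g k j)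
      = mat n n (\<lambda>(i, j). f i j) * mat n n (\<lambda>(i, j). g i j)"
    by (auto intro!: eq_matI simp: scalar_prod_def atLeast0LessThan)
  then show ?thesis
    unfolding fdet_def by (simp add: det_mult[of _ n])
qed

lemma fdet_block_lower:
  assumes "\<And>i j. i < p \<Longrightarrow> j < q \<Longrightarrow> f i (p + j) = 0"
  shows "fdet (p + q) f = fdet p f * fdet q (\<lambda>i j. f (p + i) (p + j))"
proof -
  have "mat (p + q) (p + q) (\<lambda>(i, j). f i j) =
      four_block_mat (mat p p (\<lambda>(i, j). f i j)) (0\<^sub>m p q)
        (mat q p (\<lambda>(i, j). f (p + i) j)) (mat q q (\<lambda>(i, j). f (p + i) (p + j)))"
  proof (rule eq_matI, goal_cases)
    case (1 i j)
    then show ?case using assms[of i "j - p"] by (auto simp: not_less)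
  qed auto
  then show ?thesis
    unfolding fdet_def by (simp add: det_four_block_mat_upper_right_zero[of _ p _ q])
qed

lemma fdet_block_upper:
  assumes "\<And>i j. i < q \<Longrightarrow> j < p \<Longrightarrow> f (p + i) j = 0"
  shows "fdet (p + q) f = fdet p f * fdet q (\<lambda>i j. f (p + i) (p + j))"
  using fdet_block_lower[of p q "\<lambda>i j. f j i"] assms fdet_transpose[of "p + q" f]
    fdet_transpose[of p f] fdet_transpose[of q "\<lambda>i j. f (p + i) (p + j)"] by simp

lemma fdet_equal_rows:
  assumes "r < n" "s < n" "r \<noteq> s" "\<And>j. j < n \<Longrightarrow> f r j = f s j"
  shows "fdet n f = 0"
  unfolding fdet_def using assms
  by (intro det_identical_rows[of _ n r s]) (auto intro!: eq_vecI)

text \<open>By the pigeonhole principle no permutation maps the \<open>r + 1\<close> rows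
  \<open>0, ..., r\<close> into the \<open>r\<close> columns below \<open>r\<close>, so every
  Leibniz term meets the zero corner.\<close>

lemma fdet_zero_corner:
  assumes "r < n" "\<And>i j. i \<le> r \<Longrightarrow> r \<le> j \<Longrightarrow> j < n \<Longrightarrow> f i j = 0"
  shows "fdet n f = 0"
  unfolding fdet_leibniz
proof (intro sum.neutral ballI)
  fix p assume "p \<in> {p. p permutes {0..<n}}"
  then have p: "p permutes {0..<n}" by simp
  have "\<exists>i\<le>r. r \<le> p i"
  proof (rule ccontr)
    assume "\<not> ?thesis"
    then have "p i < r" if "i \<le> r" for i using that by (meson not_le)
    then have "p ` {..r} \<subseteq> {..<r}" by auto
    from card_inj_on_le[OF inj_on_subset[OF permutes_inj[OF p]] this] show False by simp
  qed
  then obtain i where i: "i \<le> r" "r \<le> p i" by blast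
  with assms(1) permutes_in_image[OF p, of i] have "i < n" "p i < n" by auto
  with i assms(2) have "(\<Prod>i<n. f i (p i)) = 0"
    by (intro prod_zero bexI[of _ i]) auto
  then show "signof p * (\<Prod>i<n. f i (p i)) = 0" by simp
qed

text \<open>Leibniz' formula turns a sum over modified rows into a sum over permutations of
  \<open>\<Sum>i. x i - y (p i)\<close>, which does not depend on \<open>p\<close>.\<close>
lemma fdet_sum_weighted_rows:
  fixes f :: "nat \<Rightarrow> nat \<Rightarrow> 'a::idom"
  shows "(\<Sum>r<n. fdet n (\<lambda>i j. if i = r then (x i - y j) * f i j else f i j))
    = (\<Sum>i<n. x i - y i) * fdet n f"
proof -
  have 1: "(\<Prod>i<n. if i = r then (x i - y (p i)) * f i (p i) else f i (p i))
      = (x r - y (p r)) * (\<Prod>i<n. f i (p i))" if "r < n" for r and p :: "nat \<Rightarrow> nat"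
    using that by (subst (1 2) prod.remove[of _ r]) (auto intro!: prod.cong)
  have 2: "(\<Sum>r<n. x r - y (p r)) = (\<Sum>i<n. x i - y i)" if "p permutes {0..<n}" for p
    using sum.permute[OF that, of y] by (simp add: sum_subtractf atLeast0LessThan)
  have "(\<Sum>r<n. fdet n (\<lambda>i j. if i = r then (x i - y j) * f i j else f i j))
    = (\<Sum>r<n. \<Sum>p | p permutes {0..<n}. signof p * ((x r - y (p r)) * (\<Prod>i<n. f i (p i))))"
    unfolding fdet_leibniz by (intro sum.cong refl) (simp add: 1)
  also have "\<dots> = (\<Sum>p | p permutes {0..<n}. \<Sum>r<n. (x r - y (p r)) * (signof p * (\<Prod>i<n. f i (p i))))"
    by (subst sum.swap) (simp add: ac_simps)
  also have "\<dots> = (\<Sum>p | p permutes {0..<n}. (\<Sum>i<n. x i - y i) * (signof p * (\<Prod>i<n. f i (p i))))"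
    by (intro sum.cong refl) (simp add: 2 flip: sum_distrib_right)
  finally show ?thesis by (simp add: fdet_leibniz sum_distrib_left)
qed

section \<open>Standard Young tableaux and Aitken's determinant\<close>

text \<open>These are the cells that can carry the largest entry; for a skew diagram they are its
  removable corners.\<close>

definition max_cells :: "cell set \<Rightarrow> cell set" where
  "max_cells S = {(i, j) \<in> S. (\<forall>j'. (i, j') \<in> S \<longrightarrow> j' \<le> j) \<and> (\<forall>i'. (i', j) \<in> S \<longrightarrow> i' \<le> i)}"

lemma is_syt_remove_max:
  assumes "finite S" "x \<in> S" "is_syt S T" "T x = card S"
  shows "x \<in> max_cells S" "is_syt (S - {x}) (restrict T (S - {x}))"
proof -
  have bij: "bij_betw T S {1..card S}" using assms by (simp add: is_syt_def)
  then have le: "T y \<le> card S" if "y \<in> S" for y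
    using that by (auto dest: bij_betwE)
  show "x \<in> max_cells S"
    using assms le unfolding max_cells_def is_syt_def
    by (cases x) (simp, metis not_le)
  have "T ` (S - {x}) = {1..card S} - {card S}"
    using bij assms(2,4) by (auto simp: bij_betw_def inj_on_image_set_diff[of T S])
  moreover have "{1..card S} - {card S} = {1..card (S - {x})}"
    using assms(1,2) by (auto simp: card_Diff_singleton)
  ultimately have "bij_betw T (S - {x}) {1..card (S - {x})}"
    using bij by (auto simp: bij_betw_def intro: inj_on_subset)
  then have "bij_betw (restrict T (S - {x})) (S - {x}) {1..card (S - {x})}"
    by (subst bij_betw_cong[of _ _ T]) auto
  then show "is_syt (S - {x}) (restrict T (S - {x}))"
    using assms(3) unfolding is_syt_def by auto
qed

lemma is_syt_insert_max:
  assumes "finite S" "x \<in> max_cells S" "is_syt (S - {x}) T"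
  shows "is_syt S (T(x := card S))"
proof -
  have x: "x \<in> S" using assms(2) by (auto simp: max_cells_def)
  have cS: "card S = Suc (card (S - {x}))" using x assms(1) by (metis card_Suc_Diff1)
  have bij: "bij_betw T (S - {x}) {1..card (S - {x})}" using assms(3) by (simp add: is_syt_def)
  have lt: "T y < card S" if "y \<in> S" "y \<noteq> x" for y
    using bij_betwE[OF bij] that cS by (simp add: less_Suc_eq_le)
  have "bij_betw (T(x := card S)) (S - {x}) {1..card (S - {x})}"
    using bij by (subst bij_betw_cong[of _ _ T]) auto
  then have "bij_betw (T(x := card S)) (insert x (S - {x})) (insert (card S) {1..card (S - {x})})"
    using cS notIn_Un_bij_betw[of x "S - {x}" "T(x := card S)" "{1..card (S - {x})}"] by simp
  moreover have "insert x (S - {x}) = S" using x by auto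
  moreover have "insert (card S) {1..card (S - {x})} = {1..card S}" using cS by auto
  ultimately have "bij_betw (T(x := card S)) S {1..card S}" by simp
  then show ?thesis
    using assms(2,3) lt unfolding is_syt_def max_cells_def
    by (cases x) (auto simp: not_le[symmetric])
qed

text \<open>The tableaux are classified by the position of the entry \<open>card S\<close>:
  bijectivity makes the position unique, and deleting or restoring that entry identifies each class
  with the tableaux of the smaller cell set.\<close>

lemma num_syt_remove_max:
  assumes "finite S" "S \<noteq> {}"
  shows "num_syt S = (\<Sum>x\<in>max_cells S. num_syt (S - {x}))"
proof -
  define A where "A x = {T \<in> extensional S. is_syt S T \<and> T x = card S}" for x
  define B where "B x = {T \<in> extensional (S - {x}). is_syt (S - {x}) T}" for x
  have maxS: "max_cells S \<subseteq> S" by (auto simp: max_cells_def)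
  have bij: "bij_betw (\<lambda>T. restrict T (S - {x})) (A x) (B x)" if x: "x \<in> max_cells S" for x
  proof (rule bij_betw_byWitness[where f' = "\<lambda>T. T(x := card S)"])
    have xS: "x \<in> S" using x maxS by auto
    show "\<forall>T\<in>A x. (restrict T (S - {x}))(x := card S) = T"
      using xS by (auto simp: A_def fun_eq_iff extensional_def)
    show "\<forall>T\<in>B x. restrict (T(x := card S)) (S - {x}) = T"
      by (auto simp: B_def fun_eq_iff extensional_def)
    show "(\<lambda>T. restrict T (S - {x})) ` A x \<subseteq> B x"
      using is_syt_remove_max(2)[OF assms(1) xS] by (auto simp: A_def B_def)
    show "(\<lambda>T. T(x := card S)) ` B x \<subseteq> A x"
      using is_syt_insert_max[OF assms(1) x] xS by (auto simp: A_def B_def extensional_def)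
  qed
  have "finite {T \<in> extensional S. is_syt S T}"
    by (rule finite_subset[OF _ finite_PiE[of S "\<lambda>_. {1..card S}"]])
       (auto simp: assms PiE_def is_syt_def dest: bij_betwE)
  moreover have AU: "{T \<in> extensional S. is_syt S T} = (\<Union>x\<in>max_cells S. A x)"
  proof (intro equalityI subsetI)
    fix T assume T: "T \<in> {T \<in> extensional S. is_syt S T}"
    then have "bij_betw T S {1..card S}" by (simp add: is_syt_def)
    moreover have "card S \<in> {1..card S}" using assms by (simp add: card_gt_0_iff Suc_le_eq)
    ultimately obtain x where "x \<in> S" "T x = card S" by (metis bij_betw_imp_surj_on imageE)
    then show "T \<in> (\<Union>x\<in>max_cells S. A x)"
      using T is_syt_remove_max(1)[OF assms(1), of x T] by (auto simp: A_def)
  qed (auto simp: A_def)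
  ultimately have "finite (A x)" if "x \<in> max_cells S" for x using that by (auto intro: finite_subset)
  moreover have "A x \<inter> A y = {}" if xy: "x \<in> max_cells S" "y \<in> max_cells S" "x \<noteq> y" for x y
  proof -
    have False if T: "T \<in> A x" "T \<in> A y" for T
    proof -
      have "inj_on T S" "T x = T y" using T by (auto simp: A_def is_syt_def bij_betw_def)
      then show False using xy maxS inj_onD[of T S x y] by blast
    qed
    then show ?thesis by blast
  qed
  ultimately have "num_syt S = (\<Sum>x\<in>max_cells S. card (A x))"
    unfolding num_syt_def AU using finite_subset[OF maxS assms(1)]
    by (subst card_UN_disjoint) auto
  also have "\<dots> = (\<Sum>x\<in>max_cells S. num_syt (S - {x}))"
    using bij_betw_same_card[OF bij] by (simp add: num_syt_def B_def)
  finally show ?thesis .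
qed

lemma num_syt_empty: "num_syt {} = 1"
  by (simp add: num_syt_def is_syt_def bij_betw_def)

section \<open>Aitken's determinant for skew shapes\<close>

definition inv_fact :: "int \<Rightarrow> real" where
  "inv_fact k = (if k < 0 then 0 else 1 / fact (nat k))"

text \<open>The value 0 at negative integers makes this valid without a sign condition. It turns the
  removal of a cell from row \<open>r\<close> into multiplication of the entries of that row by
  \<open>l_r - m_j\<close>.\<close>

lemma inv_fact_pred: "inv_fact (k - 1) = real_of_int k * inv_fact k"
proof (cases "k \<ge> 1")
  case True
  then have "nat k = Suc (nat (k - 1))" by simp
  then have "(fact (nat k) :: real) = real_of_int k * fact (nat (k - 1))"
    using True by (simp only: fact_Suc) (simp add: of_nat_nat)
  then show ?thesis using True by (simp add: inv_fact_def)
qed (auto simp: inv_fact_def)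

text \<open>Rows are counted from the bottom: \<open>lam i\<close> and \<open>mu i\<close> belong to row \<open>N - i\<close> of the diagram,
  so partitions are weakly increasing functions of \<open>i\<close>, and the numbers \<open>lam i + i\<close> increase
  strictly.\<close>
definition skew_cells :: "nat \<Rightarrow> (nat \<Rightarrow> nat) \<Rightarrow> (nat \<Rightarrow> nat) \<Rightarrow> cell set" where
  "skew_cells N lam mu = {(N - i, j) | i j. i < N \<and> mu i < j \<and> j \<le> lam i}"

lemma skew_cells_iff:
  assumes "i < N"
  shows "(N - i, j) \<in> skew_cells N lam mu \<longleftrightarrow> mu i < j \<and> j \<le> lam i"
proof
  assume "(N - i, j) \<in> skew_cells N lam mu"
  then obtain i' where "N - i = N - i'" "i' < N" "mu i' < j" "j \<le> lam i'"
    by (auto simp: skew_cells_def)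
  moreover from this assms have "i' = i" by linarith
  ultimately show "mu i < j \<and> j \<le> lam i" by simp
qed (use assms in \<open>auto simp: skew_cells_def\<close>)

lemma skew_cells_Sigma:
  "skew_cells N lam mu = (\<lambda>(i, j). (N - i, j)) ` Sigma {..<N} (\<lambda>i. {mu i<..lam i})"
  by (auto simp: skew_cells_def image_iff)

lemma finite_skew_cells: "finite (skew_cells N lam mu)"
  unfolding skew_cells_Sigma by (intro finite_imageI finite_SigmaI) auto

lemma card_skew_cells: "card (skew_cells N lam mu) = (\<Sum>i<N. lam i - mu i)"
proof -
  have "inj_on (\<lambda>(i, j). (N - i, j)) (Sigma {..<N} (\<lambda>i. {mu i<..lam i}))"
    by (auto simp: inj_on_def)
  then show ?thesis unfolding skew_cells_Sigma by (simp add: card_image)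
qed

definition corner_rows :: "nat \<Rightarrow> (nat \<Rightarrow> nat) \<Rightarrow> (nat \<Rightarrow> nat) \<Rightarrow> nat set" where
  "corner_rows N lam mu = {r. r < N \<and> mu r < lam r \<and> (\<forall>i<r. lam i < lam r)}"

text \<open>Rows \<open>i < r\<close> lie below row \<open>r\<close>. If such a row has
  \<open>lam r \<le> lam i\<close>, monotonicity of \<open>mu\<close> gives
  \<open>mu i < lam r\<close>, so it has a cell below the last cell of row \<open>r\<close>.\<close>

lemma max_cells_skew_cells:
  assumes "mono_on {..<N} mu"
  shows "max_cells (skew_cells N lam mu) = (\<lambda>r. (N - r, lam r)) ` corner_rows N lam mu"
proof (intro equalityI subsetI)
  fix x assume x: "x \<in> max_cells (skew_cells N lam mu)"
  then obtain r j where r: "x = (N - r, j)" "r < N" "mu r < j" "j \<le> lam r"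
    by (auto simp: max_cells_def skew_cells_def)
  have "(N - r, lam r) \<in> skew_cells N lam mu" using r by (simp add: skew_cells_iff)
  then have j: "j = lam r" using x r by (fastforce simp: max_cells_def)
  have "lam i < lam r" if i: "i < r" for i
  proof (rule ccontr)
    assume "\<not> lam i < lam r"
    moreover have "mu i \<le> mu r" using assms i r by (auto simp: mono_on_def)
    ultimately have "(N - i, j) \<in> skew_cells N lam mu" using r i j by (simp add: skew_cells_iff)
    then have "N - i \<le> N - r" using x r by (auto simp: max_cells_def)
    then show False using i r by linarith
  qed
  then show "x \<in> (\<lambda>r. (N - r, lam r)) ` corner_rows N lam mu"
    using r j by (auto simp: corner_rows_def)
next
  fix x assume "x \<in> (\<lambda>r. (N - r, lam r)) ` corner_rows N lam mu"
  then obtain r where r: "x = (N - r, lam r)" "r < N" "mu r < lam r" "\<And>i. i < r \<Longrightarrow> lam i < lam r"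
    by (auto simp: corner_rows_def)
  have "i' \<le> N - r" if "(i', lam r) \<in> skew_cells N lam mu" for i'
  proof -
    from that obtain i where i: "i' = N - i" "i < N" "lam r \<le> lam i"
      by (auto simp: skew_cells_def)
    then have "\<not> i < r" using r(4)[of i] by auto
    then show ?thesis using i by simp
  qed
  then show "x \<in> max_cells (skew_cells N lam mu)"
    using r by (auto simp: max_cells_def skew_cells_iff)
qed

lemma skew_cells_remove:
  assumes "r < N" "mu r < lam r"
  shows "skew_cells N lam mu - {(N - r, lam r)} = skew_cells N (lam(r := lam r - 1)) mu"
proof (rule Set.set_eqI)
  fix x :: cell
  show "x \<in> skew_cells N lam mu - {(N - r, lam r)} \<longleftrightarrow>
        x \<in> skew_cells N (lam(r := lam r - 1)) mu"
  proof (cases "\<exists>i j. x = (N - i, j) \<and> i < N")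
    case True
    then obtain i j where i: "x = (N - i, j)" "i < N" by blast
    then have "x = (N - r, lam r) \<longleftrightarrow> i = r \<and> j = lam r" using assms by auto
    then show ?thesis using i assms by (auto simp: skew_cells_iff)
  next
    case False
    then show ?thesis by (auto simp: skew_cells_def)
  qed
qed

text \<open>Induction on the number of cells: lowering one row at a time and summing the
  determinants over all rows multiplies the determinant by the number of cells. Corner rows give the
  smaller shapes, and all other rows contribute zero.\<close>

lemma num_syt_skew:
  assumes "mono_on {..<N} lam" "mono_on {..<N} mu" "\<And>i. i < N \<Longrightarrow> mu i \<le> lam i"
  shows "real (num_syt (skew_cells N lam mu)) =
    fact (card (skew_cells N lam mu)) *
    fdet N (\<lambda>i j. inv_fact (int (lam i + i) - int (mu j + j)))"
  using assms
proof (induction "card (skew_cells N lam mu)" arbitrary: lam)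
  case 0
  have "(\<Sum>i<N. lam i - mu i) = 0" using 0(1) by (simp add: card_skew_cells)
  then have eq: "lam i = mu i" if "i < N" for i using 0(4)[of i] that by (simp add: le_antisym)
  have "skew_cells N lam mu = {}" using eq by (auto simp: skew_cells_def)
  moreover have "fdet N (\<lambda>i j. inv_fact (int (lam i + i) - int (mu j + j)))
     = (\<Prod>i<N. inv_fact (int (lam i + i) - int (mu i + i)))"
  proof (rule fdet_lower_triangular)
    fix i j assume ij: "i < j" "j < N"
    then have "mu i \<le> mu j" using 0(3) by (auto simp: mono_on_def)
    then show "inv_fact (int (lam i + i) - int (mu j + j)) = 0"
      using ij eq[of i] by (simp add: inv_fact_def)
  qed
  ultimately show ?case using eq by (simp add: num_syt_empty inv_fact_def)
next
  case (Suc n lam)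
  let ?S = "skew_cells N lam mu"
  let ?l = "\<lambda>i. int (lam i + i)" and ?m = "\<lambda>j. int (mu j + j)"
  let ?f = "\<lambda>i j. inv_fact (?l i - ?m j)"
  \<comment> \<open>The matrix with \<open>lam r\<close> lowered by 1, written with weights so that
    \<open>fdet_sum_weighted_rows\<close> applies.\<close>
  define g where "g r i j = (if i = r then (real_of_int (?l i) - real_of_int (?m j)) * ?f i j else ?f i j)" for r i j
  let ?R = "corner_rows N lam mu"
  note cardS = Suc(2)[symmetric]
  have g_pred: "g r r j = inv_fact (?l r - 1 - ?m j)" for r j
    using inv_fact_pred[of "?l r - ?m j"] by (simp add: g_def algebra_simps)
  have corner: "real (num_syt (?S - {(N - r, lam r)})) = fact n * fdet N (g r)" if r: "r \<in> ?R" for r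
  proof -
    let ?lam = "lam(r := lam r - 1)"
    have rN: "r < N" "mu r < lam r" "\<And>i. i < r \<Longrightarrow> lam i < lam r"
      using r by (auto simp: corner_rows_def)
    have S: "?S - {(N - r, lam r)} = skew_cells N ?lam mu"
      using rN by (intro skew_cells_remove)
    have "(N - r, lam r) \<in> ?S" using rN by (simp add: skew_cells_iff)
    then have n: "card (skew_cells N ?lam mu) = n"
      unfolding S[symmetric] using cardS by (simp add: finite_skew_cells)
    have "mono_on {..<N} ?lam"
    proof (rule mono_onI)
      fix i j assume ij: "i \<in> {..<N}" "j \<in> {..<N}" "i \<le> j"
      then have "lam i \<le> lam j" using Suc(3) by (auto simp: mono_on_def)
      then show "?lam i \<le> ?lam j" using ij rN(3)[of i] by auto
    qed
    moreover have "mu i \<le> ?lam i" if "i < N" for i using Suc(5)[OF that] rN by auto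
    ultimately have "real (num_syt (skew_cells N ?lam mu)) =
        fact n * fdet N (\<lambda>i j. inv_fact (int (?lam i + i) - ?m j))"
      using Suc(1)[of ?lam] Suc(4) n by simp
    also have "fdet N (\<lambda>i j. inv_fact (int (?lam i + i) - ?m j)) = fdet N (g r)"
    proof (rule fdet_cong)
      fix i j
      show "inv_fact (int (?lam i + i) - ?m j) = g r i j"
      proof (cases "i = r")
        case True
        then show ?thesis using g_pred[of r j] rN by (simp add: of_nat_diff algebra_simps)
      qed (simp add: g_def)
    qed
    finally show ?thesis unfolding S .
  qed
  \<comment> \<open>Either row \<open>r\<close> is empty, and the lowered matrix has a zero corner,
    or the row just below has the same length, and lowering \<open>l_r\<close> by 1 makes the two
    matrix rows equal.\<close>
  have no_corner: "fdet N (g r) = 0" if r: "r < N" "r \<notin> ?R" for r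
  proof (cases "mu r < lam r")
    case False
    then have eq: "lam r = mu r" using Suc(5) r by (simp add: le_antisym)
    show ?thesis
    proof (rule fdet_zero_corner[OF r(1)])
      fix i j assume ij: "i \<le> r" "r \<le> j" "j < N"
      then have *: "lam i \<le> lam r" "mu r \<le> mu j" using Suc(3,4) r by (auto simp: mono_on_def)
      show "g r i j = 0"
      proof (cases "i = r")
        case True
        then show ?thesis using g_pred[of r j] * ij eq by (simp add: inv_fact_def)
      next
        case False
        then show ?thesis using * ij eq by (simp add: g_def inv_fact_def)
      qed
    qed
  next
    case True
    then obtain i where i: "i < r" "lam r \<le> lam i" using r by (auto simp: corner_rows_def not_less)
    have "lam i \<le> lam (r - 1)" "lam (r - 1) \<le> lam r"
      using i r mono_onD[OF Suc(3), of i "r - 1"] mono_onD[OF Suc(3), of "r - 1" r] by simp_all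
    then have "?l r - 1 = ?l (r - 1)" using i by (simp add: of_nat_diff)
    then have "g r r j = ?f (r - 1) j" for j unfolding g_pred by presburger
    then have "g r r j = g r (r - 1) j" for j using i by (simp add: g_def)
    then show ?thesis using i r by (intro fdet_equal_rows[of r _ "r - 1"]) auto
  qed
  \<comment> \<open>The shifts by \<open>i\<close> cancel, so the total weight is the number of
    cells; this factor turns \<open>fact n\<close> into \<open>fact (Suc n)\<close>.\<close>
  have sum: "(\<Sum>i<N. real_of_int (?l i) - real_of_int (?m i)) = Suc n"
  proof -
    have "(\<Sum>i<N. real_of_int (?l i) - real_of_int (?m i)) = (\<Sum>i<N. real (lam i - mu i))"
      using Suc(5) by (intro sum.cong) (auto simp: of_nat_diff)
    then show ?thesis using cardS by (simp add: card_skew_cells flip: of_nat_sum)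
  qed
  have "real (num_syt ?S) = (\<Sum>x\<in>max_cells ?S. real (num_syt (?S - {x})))"
    using cardS by (subst num_syt_remove_max) (auto simp: finite_skew_cells)
  also have "\<dots> = (\<Sum>r\<in>?R. real (num_syt (?S - {(N - r, lam r)})))"
    unfolding max_cells_skew_cells[OF Suc(4)]
    by (subst sum.reindex) (auto simp: inj_on_def corner_rows_def)
  also have "\<dots> = (\<Sum>r\<in>?R. fact n * fdet N (g r))"
    using corner by (intro sum.cong) auto
  also have "\<dots> = (\<Sum>r<N. fact n * fdet N (g r))"
    using no_corner by (intro sum.mono_neutral_left) (auto simp: corner_rows_def)
  also have "\<dots> = fact n * (real (Suc n) * fdet N ?f)"
    using fdet_sum_weighted_rows[of N "\<lambda>i. real_of_int (?l i)" "\<lambda>j. real_of_int (?m j)" ?f]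
    unfolding sum g_def[abs_def] sum_distrib_left[symmetric] by simp
  also have "\<dots> = fact (card ?S) * fdet N ?f" by (simp add: cardS algebra_simps)
  finally show ?case .
qed

section \<open>Newton bases\<close>

definition newton :: "(nat \<Rightarrow> 'a::idom) \<Rightarrow> nat \<Rightarrow> 'a \<Rightarrow> 'a" where
  "newton \<eta> s x = (\<Prod>t<s. x - \<eta> t)"

lemma newton_Suc: "newton \<eta> (Suc s) x = (x - \<eta> s) * newton \<eta> s x"
  by (simp add: newton_def mult.commute)

lemma prod_lessThan_add: "prod f {..<m + n} = prod f {..<m} * (\<Prod>i<n. f (m + i))"
  for f :: "nat \<Rightarrow> 'a::comm_monoid_mult"
  by (induction n) (simp_all add: mult.assoc)

lemma newton_eq_0: "t < s \<Longrightarrow> newton \<eta> s (\<eta> t) = 0"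
  by (auto simp: newton_def)

lemma newton_add: "newton \<eta> (s + k) x = newton \<eta> s x * newton (\<lambda>t. \<eta> (s + t)) k x"
  by (induction k) (simp_all add: newton_def mult.assoc)

text \<open>Both families are monic and agree in degree \<open>s\<close>. In the induction the new
  factor is split as \<open>x - \<eta> (s + k) = (x - \<zeta> (s + i)) + (\<zeta> (s + i) - \<eta>
  (s + k))\<close>: the first summand raises the degree (\<open>u\<close>), the second keeps it
  (\<open>v\<close>).\<close>

lemma newton_change_basis:
  assumes "\<And>x. newton \<eta> s x = newton \<zeta> s x"
  shows "\<exists>c. c k = 1 \<and> (\<forall>x. newton \<eta> (s + k) x = (\<Sum>i\<le>k. c i * newton \<zeta> (s + i) x))"
proof (induction k)
  case 0
  then show ?case by (intro exI[of _ "\<lambda>_. 1"]) (simp add: assms)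
next
  case (Suc k)
  then obtain c where c: "c k = 1" "\<And>x. newton \<eta> (s + k) x = (\<Sum>i\<le>k. c i * newton \<zeta> (s + i) x)"
    by blast
  define u where "u i = (case i of 0 \<Rightarrow> 0 | Suc i' \<Rightarrow> c i')" for i
  define v where "v i = (if i \<le> k then c i * (\<zeta> (s + i) - \<eta> (s + k)) else 0)" for i
  have "newton \<eta> (s + Suc k) x = (\<Sum>i\<le>Suc k. (u i + v i) * newton \<zeta> (s + i) x)" for x
  proof -
    have "newton \<eta> (s + Suc k) x = (\<Sum>i\<le>k. c i * ((x - \<eta> (s + k)) * newton \<zeta> (s + i) x))"
      by (simp add: newton_Suc c(2) sum_distrib_left mult.left_commute)
    also have "\<dots> = (\<Sum>i\<le>k. c i * newton \<zeta> (s + Suc i) x) + (\<Sum>i\<le>k. v i * newton \<zeta> (s + i) x)"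
      unfolding sum.distrib[symmetric]
      by (intro sum.cong) (auto simp: newton_Suc v_def algebra_simps)
    also have "(\<Sum>i\<le>k. c i * newton \<zeta> (s + Suc i) x) = (\<Sum>i\<le>Suc k. u i * newton \<zeta> (s + i) x)"
      by (simp only: sum.atMost_Suc_shift) (simp add: u_def)
    also have "(\<Sum>i\<le>k. v i * newton \<zeta> (s + i) x) = (\<Sum>i\<le>Suc k. v i * newton \<zeta> (s + i) x)"
      by (simp add: v_def)
    finally show ?thesis by (simp only: sum.distrib[symmetric] distrib_right)
  qed
  moreover have "u (Suc k) + v (Suc k) = 1" by (simp add: u_def v_def c(1))
  ultimately show ?case by (intro exI[of _ "\<lambda>i. u i + v i"]) blast
qed

text \<open>The polynomials of degrees \<open>0, \<dots>, p - 1, s, s + 1, \<dots>\<close> in the two Newton bases span the same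
  flag because the two bases agree in degree \<open>s\<close>.\<close>
lemma fdet_newton_change_nodes:
  fixes e :: "nat \<Rightarrow> nat"
  assumes eq: "\<And>x. newton \<eta> s x = newton \<zeta> s x"
    and e: "\<And>j. e j = (if j < p then j else s + (j - p))"
  shows "fdet n (\<lambda>i j. newton \<eta> (e j) (x i)) = fdet n (\<lambda>i j. newton \<zeta> (e j) (x i))"
proof -
  \<comment> \<open>Below \<open>p\<close> the expansion starts from degree 0, where both bases
    equal 1; from \<open>p\<close> on it starts from degree \<open>s\<close>, so no degree missing
    from \<open>e\<close> occurs.\<close>
  have "\<exists>c. c j = 1 \<and> (\<forall>y. newton \<eta> (e j) y = (\<Sum>k\<le>j. c k * newton \<zeta> (e k) y))" for j
  proof (cases "j < p")
    case True
    have "\<exists>c. c j = 1 \<and> (\<forall>y. newton \<eta> (0 + j) y = (\<Sum>k\<le>j. c k * newton \<zeta> (0 + k) y))"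
      by (rule newton_change_basis) (simp add: newton_def)
    then show ?thesis using True by (auto simp: e)
  next
    case False
    obtain c where c: "c (j - p) = 1"
      "\<And>y. newton \<eta> (s + (j - p)) y = (\<Sum>k\<le>j - p. c k * newton \<zeta> (s + k) y)"
      using newton_change_basis[OF eq, of "j - p"] by blast
    have "(\<Sum>k\<le>j - p. c k * newton \<zeta> (s + k) y)
        = (\<Sum>k\<le>j. (if k < p then 0 else c (k - p)) * newton \<zeta> (e k) y)" for y
      using False
      by (intro sum.reindex_bij_witness_not_neutral[of "{}" "{..<p}" _ "\<lambda>k. k - p" "\<lambda>k. k + p"])
         (auto simp: e)
    then show ?thesis using False c
      by (intro exI[of _ "\<lambda>k. if k < p then 0 else c (k - p)"]) (simp add: e)
  qed
  then obtain C where C: "\<And>j. C j j = 1"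
    "\<And>j y. newton \<eta> (e j) y = (\<Sum>k\<le>j. C j k * newton \<zeta> (e k) y)"
    by metis
  \<comment> \<open>The transition matrix is upper triangular with ones on the diagonal, hence has
    determinant 1.\<close>
  define U where "U k j = (if k \<le> j then C j k else 0)" for k j
  have "fdet n (\<lambda>i j. newton \<eta> (e j) (x i)) = fdet n (\<lambda>i j. \<Sum>k<n. newton \<zeta> (e k) (x i) * U k j)"
    by (intro fdet_cong, unfold C(2), intro sum.mono_neutral_cong_left)
       (auto simp: U_def mult.commute)
  also have "\<dots> = fdet n (\<lambda>i j. newton \<zeta> (e j) (x i)) * fdet n U" by (rule fdet_mult)
  also have "fdet n U = 1" by (subst fdet_upper_triangular) (auto simp: U_def C(1))
  finally show ?thesis by simp
qed

section \<open>Falling factorials and the reduction to a small determinant\<close>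

lemma inv_fact_eq_newton:
  "inv_fact (int l - int m) = newton real m (real l) / fact l"
proof (cases "m \<le> l")
  case True
  have "newton real m (real l) = fact m * real (l choose m)"
    unfolding binomial_gbinomial gbinomial_mult_fact by (simp add: newton_def atLeast0LessThan)
  also have "\<dots> = fact l / fact (l - m)" using True by (simp add: binomial_fact)
  moreover have "nat (int l - int m) = l - m" using True by simp
  ultimately show ?thesis using True by (simp add: inv_fact_def)
next
  case False
  \<comment> \<open>Here \<open>l\<close> is itself one of the nodes \<open>0, ..., m - 1\<close>,
    so both sides vanish.\<close>
  then show ?thesis using newton_eq_0[of l m real] by (simp add: inv_fact_def)
qed

lemma newton_progression:
  fixes x r :: real
  assumes "r \<noteq> 0"
  shows "newton (\<lambda>t. r * real t) s x = r ^ s * (fact s * ((x / r) gchoose s))"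
proof -
  have "newton (\<lambda>t. r * real t) s x = (\<Prod>t<s. r * (x / r - real t))"
    unfolding newton_def using assms by (intro prod.cong) (auto simp: algebra_simps)
  also have "\<dots> = r ^ s * (\<Prod>t<s. x / r - real t)" by (simp add: prod.distrib)
  finally show ?thesis unfolding gbinomial_mult_fact by (simp add: atLeast0LessThan)
qed

text \<open>With the \<open>l i\<close> as first nodes, the short rows vanish in all columns from
  \<open>M\<close> on. The block of the long rows then has the row factors
  \<open>\<Prod>t<M. x i - l t\<close>, and its remaining entries are Newton polynomials on
  multiples of \<open>r\<close>, that is, scaled binomial coefficients.\<close>

lemma fdet_falling_reduce:
  fixes l :: "nat \<Rightarrow> nat" and x :: "nat \<Rightarrow> nat" and a b c M r :: nat
  defines "K \<equiv> M + b + c"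
  defines "s \<equiv> \<lambda>j. if j < c then j else b + j"
  assumes r: "r > 0"
    and part: "l ` {..<M} \<union> (\<lambda>t. r * t) ` {..<b + c} = {..<K}"
    and inj: "inj_on l {..<M}"
    and x: "\<And>i. i < c + a \<Longrightarrow> K \<le> x i"
  shows "fdet (M + (c + a)) (\<lambda>i j. inv_fact (int (if i < M then l i else x (i - M))
        - int ((if j < M + c then 0 else b) + j))) =
      (\<Prod>i<M. \<Prod>t<i. real (l i) - real (l t)) / (\<Prod>i<M. fact (l i))
      * (\<Prod>i<c + a. 1 / (fact (x i - K) * (\<Prod>t<b + c. real (x i) - r * real t)))
      * ((\<Prod>j<c + a. real r ^ s j * fact (s j))
        * fdet (c + a) (\<lambda>i j. (real (x i) / r) gchoose s j))"
proof -
  define y where "y i = (if i < M then l i else x (i - M))" for i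
  \<comment> \<open>The degree \<open>e j\<close> is the beta-number of row \<open>j\<close> of the
    inner shape: the \<open>b\<close> cells removed from the top \<open>a\<close> rows make the
    degrees jump from \<open>M + c\<close> to \<open>K\<close>.\<close>
  define e where "e j = (if j < M + c then j else K + (j - (M + c)))" for j
  define \<eta> where "\<eta> t = (if t < M then real (l t) else real r * real (t - M))" for t
  define PL where "PL z = (\<Prod>t<M. z - real (l t))" for z :: real
  \<comment> \<open>The two sets have \<open>M\<close> and \<open>b + c\<close> elements and their
    union has \<open>K = M + b + c\<close>, so they cannot overlap.\<close>
  have disj: "l ` {..<M} \<inter> (\<lambda>t. r * t) ` {..<b + c} = {}"
  proof -
    have "card (l ` {..<M} \<union> (\<lambda>t. r * t) ` {..<b + c}) = K" unfolding part by simp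
    moreover have "card (l ` {..<M}) = M" using inj by (simp add: card_image)
    moreover have "card ((\<lambda>t. r * t) ` {..<b + c}) = b + c"
      using r by (subst card_image) (auto simp: inj_on_def)
    ultimately have "card (l ` {..<M} \<inter> (\<lambda>t. r * t) ` {..<b + c}) = 0"
      using card_Un_Int[of "l ` {..<M}" "(\<lambda>t. r * t) ` {..<b + c}"] by (simp add: K_def)
    then show ?thesis by simp
  qed
  have newton_\<eta>: "newton \<eta> (M + k) z = PL z * newton (\<lambda>t. real r * real t) k z" for k z
    unfolding newton_add by (simp add: newton_def PL_def \<eta>_def)
  have split: "newton real K z = PL z * (\<Prod>t<b + c. z - r * real t)" for z
  proof -
    have "newton real K z = (\<Prod>u\<in>l ` {..<M} \<union> (\<lambda>t. r * t) ` {..<b + c}. z - real u)"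
      unfolding part newton_def ..
    also have "\<dots> = (\<Prod>u\<in>l ` {..<M}. z - real u) * (\<Prod>u\<in>(\<lambda>t. r * t) ` {..<b + c}. z - real u)"
      using disj by (intro prod.union_disjoint) auto
    also have "\<dots> = PL z * (\<Prod>t<b + c. z - r * real t)"
      using inj r by (subst (1 2) prod.reindex) (auto simp: inj_on_def PL_def)
    finally show ?thesis .
  qed
  \<comment> \<open>In degree \<open>K\<close> the nodes of both bases are exactly the numbers below
    \<open>K\<close>, only in a different order.\<close>
  have eqK: "newton \<eta> K z = newton real K z" for z
    unfolding split using newton_\<eta>[of "b + c" z] by (simp add: K_def add.assoc newton_def)
  have eMj: "e (M + j) = M + s j" for j by (auto simp: e_def s_def K_def)
  have e_ge: "j \<le> e j" for j by (auto simp: e_def K_def)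
  \<comment> \<open>The full product over the nodes below \<open>K\<close> is
    \<open>fact (x i) / fact (x i - K)\<close>; dividing by its progression part, which is positive
    because \<open>K \<le> x i\<close>, isolates \<open>PL\<close>.\<close>
  have PL: "PL (x i) / fact (x i) = 1 / (fact (x i - K) * (\<Prod>t<b + c. real (x i) - r * real t))"
    if "i < c + a" for i
  proof -
    have "r * t \<in> {..<K}" if "t < b + c" for t using that unfolding part[symmetric] by auto
    then have "real (r * t) < real (x i)" if "t < b + c" for t
      unfolding of_nat_less_iff using x[OF \<open>i < c + a\<close>] that by (meson lessThan_iff less_le_trans)
    then have pos: "(\<Prod>t<b + c. real (x i) - r * real t) > 0" (is "?Q > 0")
      by (intro prod_pos) auto
    have "newton real K (real (x i)) / fact (x i) = 1 / fact (x i - K)"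
      using x[OF that] unfolding inv_fact_eq_newton[symmetric]
      by (simp add: inv_fact_def nat_diff_distrib)
    then have eq: "PL (x i) / fact (x i) * ?Q = 1 / fact (x i - K)" by (simp add: split)
    have "PL (x i) / fact (x i) = PL (x i) / fact (x i) * ?Q / ?Q"
      by (rule nonzero_mult_div_cancel_right[OF less_imp_neq[OF pos, symmetric], symmetric])
    then show ?thesis unfolding eq by (simp only: divide_divide_eq_left)
  qed
  let ?N = "M + (c + a)"
  have "fdet ?N (\<lambda>i j. inv_fact (int (y i) - int ((if j < M + c then 0 else b) + j)))
      = fdet ?N (\<lambda>i j. 1 / fact (y i) * newton real (e j) (real (y i)))"
  proof (rule fdet_cong)
    fix i j
    have "(if j < M + c then 0 else b) + j = e j" by (simp add: e_def K_def)
    then show "inv_fact (int (y i) - int ((if j < M + c then 0 else b) + j))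
      = 1 / fact (y i) * newton real (e j) (real (y i))"
      by (simp only: inv_fact_eq_newton) simp
  qed
  also have "\<dots> = (\<Prod>i<?N. 1 / fact (y i)) * fdet ?N (\<lambda>i j. newton real (e j) (real (y i)))"
    by (rule fdet_scale_rows)
  also have "fdet ?N (\<lambda>i j. newton real (e j) (real (y i))) = fdet ?N (\<lambda>i j. newton \<eta> (e j) (real (y i)))"
    by (rule fdet_newton_change_nodes[where s = K and p = "M + c", symmetric]) (auto simp: eqK e_def)
  also have "\<dots> = fdet M (\<lambda>i j. newton \<eta> (e j) (real (y i)))
      * fdet (c + a) (\<lambda>i j. newton \<eta> (e (M + j)) (real (y (M + i))))"
  proof (rule fdet_block_lower)
    fix i j assume "i < M" "j < c + a"
    then show "newton \<eta> (e (M + j)) (real (y i)) = 0"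
      using newton_eq_0[of i "e (M + j)" \<eta>] by (simp add: y_def eMj \<eta>_def)
  qed
  also have "fdet M (\<lambda>i j. newton \<eta> (e j) (real (y i))) = (\<Prod>i<M. newton \<eta> (e i) (real (y i)))"
  proof (rule fdet_lower_triangular)
    fix i j assume "i < j" "j < M"
    then show "newton \<eta> (e j) (real (y i)) = 0"
      using newton_eq_0[of i "e j" \<eta>] e_ge[of j] by (simp add: y_def \<eta>_def)
  qed
  also have "\<dots> = (\<Prod>i<M. \<Prod>t<i. real (l i) - real (l t))"
    by (intro prod.cong) (auto simp: y_def e_def newton_def \<eta>_def)
  also have "fdet (c + a) (\<lambda>i j. newton \<eta> (e (M + j)) (real (y (M + i))))
     = fdet (c + a) (\<lambda>i j. PL (x i) * ((real r ^ s j * fact (s j)) * ((real (x i) / r) gchoose s j)))"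
    using r by (intro fdet_cong) (simp add: y_def eMj newton_\<eta> newton_progression)
  also have "\<dots> = (\<Prod>i<c + a. PL (x i)) * ((\<Prod>j<c + a. real r ^ s j * fact (s j))
     * fdet (c + a) (\<lambda>i j. (real (x i) / r) gchoose s j))"
    unfolding fdet_scale_rows fdet_scale_cols by simp
  also have "(\<Prod>i<?N. 1 / fact (y i)) = (\<Prod>i<M. 1 / fact (l i)) * (\<Prod>i<c + a. 1 / fact (x i) :: real)"
    by (simp add: prod_lessThan_add y_def)
  finally have "fdet ?N (\<lambda>i j. inv_fact (int (y i) - int ((if j < M + c then 0 else b) + j))) =
      (\<Prod>i<M. \<Prod>t<i. real (l i) - real (l t)) / (\<Prod>i<M. fact (l i))
      * (\<Prod>i<c + a. PL (x i) / fact (x i))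
      * ((\<Prod>j<c + a. real r ^ s j * fact (s j))
        * fdet (c + a) (\<lambda>i j. (real (x i) / r) gchoose s j))"
    by (simp add: prod_dividef)
  then show ?thesis by (simp add: y_def PL)
qed

section \<open>Determinants of binomial coefficients\<close>

text \<open>Vandermonde convolution, with a summation range independent of \<open>n\<close>. The
  guard is needed because truncated subtraction would give \<open>z gchoose 0 = 1\<close> for
  \<open>k > n\<close>.\<close>

lemma gbinomial_add_nat:
  fixes z :: real
  shows "(z + real j) gchoose n =
    (\<Sum>k\<le>j. real (j choose k) * (if k \<le> n then z gchoose (n - k) else 0))"
proof -
  have "(z + real j) gchoose n = (\<Sum>k\<in>{0..n}. real (j choose k) * (z gchoose (n - k)))"
    unfolding binomial_gbinomial gbinomial_Vandermonde by (simp add: add.commute)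
  also have "\<dots> = (\<Sum>k\<in>{0..n} \<union> {..j}. real (j choose k) * (if k \<le> n then z gchoose (n - k) else 0))"
    by (intro sum.mono_neutral_cong_left) auto
  also have "\<dots> = (\<Sum>k\<le>j. real (j choose k) * (if k \<le> n then z gchoose (n - k) else 0))"
    by (intro sum.mono_neutral_right) (auto simp: binomial_eq_0)
  finally show ?thesis .
qed

text \<open>By Vandermonde the matrix is the unitriangular Pascal matrix times \<open>H\<close>. The
  first \<open>c\<close> columns of \<open>H\<close> are upper unitriangular, so only its lower
  right block survives.\<close>

lemma fdet_gbinomial_gap:
  fixes z :: real
  shows "fdet (c + a) (\<lambda>i j. (z + real i) gchoose (if j < c then j else b + j)) =
    fdet a (\<lambda>i j. if i \<le> b + j then z gchoose (b + j - i) else 0)"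
proof -
  define s where "s j = (if j < c then j else b + j)" for j
  define H where "H k j = (if k \<le> s j then z gchoose (s j - k) else 0)" for k j
  have "fdet (c + a) (\<lambda>i j. (z + real i) gchoose s j)
      = fdet (c + a) (\<lambda>i j. \<Sum>k<c + a. real (i choose k) * H k j)"
    unfolding gbinomial_add_nat H_def
    by (intro fdet_cong sum.mono_neutral_left) (auto simp: binomial_eq_0)
  also have "\<dots> = fdet (c + a) (\<lambda>i k. real (i choose k)) * fdet (c + a) H"
    by (rule fdet_mult)
  also have "fdet (c + a) (\<lambda>i k. real (i choose k)) = 1"
    by (subst fdet_lower_triangular) (auto simp: binomial_eq_0)
  also have "fdet (c + a) H = fdet c H * fdet a (\<lambda>i j. H (c + i) (c + j))"
    by (rule fdet_block_upper) (auto simp: H_def s_def)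
  also have "fdet c H = 1"
    by (subst fdet_upper_triangular) (auto simp: H_def s_def)
  also have "fdet a (\<lambda>i j. H (c + i) (c + j))
      = fdet a (\<lambda>i j. if i \<le> b + j then z gchoose (b + j - i) else 0)"
    by (intro fdet_cong) (auto simp: H_def s_def intro!: arg_cong[of _ _ "\<lambda>k. z gchoose k"])
  finally show ?thesis by (simp add: s_def)
qed

lemma fdet_gbinomial_consecutive: "fdet a (\<lambda>i j. (z + real i) gchoose j) = (1 :: real)"
  using fdet_gbinomial_gap[of a 0 z 0] by (simp add: fdet_leibniz)

text \<open>Right multiplication by a Pascal matrix turns the entries into
  \<open>(z + j) gchoose (b + j - i)\<close>. Such an entry is a row factor times a column factor
  times \<open>(b + j) gchoose i\<close>, and the latter matrix has determinant 1. The bound on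
  \<open>z\<close> keeps the Pochhammer symbols \<open>P k\<close> positive.\<close>

lemma fdet_gbinomial_toeplitz:
  fixes z :: real
  assumes "z > real b - 1"
  shows "fdet a (\<lambda>i j. if i \<le> b + j then z gchoose (b + j - i) else 0) =
    (\<Prod>j<a. (\<Prod>t<b. z - real b + 1 + real j + real t) * fact j / fact (b + j))"
proof -
  define H where "H i j = (if i \<le> b + j then z gchoose (b + j - i) else 0)" for i j
  define P where "P = pochhammer (z - real b + 1)"
  have P_pos: "P k > 0" for k using assms by (auto simp: P_def intro!: pochhammer_pos)
  have "fdet a (\<lambda>i j. \<Sum>k<a. H i k * real (j choose k)) = fdet a H * fdet a (\<lambda>k j. real (j choose k))"
    by (rule fdet_mult)
  also have "fdet a (\<lambda>k j. real (j choose k)) = 1"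
    by (subst fdet_upper_triangular) (auto simp: binomial_eq_0)
  finally have "fdet a H = fdet a (\<lambda>i j. \<Sum>k<a. H i k * real (j choose k))" by simp
  also have "\<dots> = fdet a (\<lambda>i j. inverse (P i) * fact i * (P (b + j) / fact (b + j)
      * (real (b + j) gchoose i)))"
  proof (rule fdet_cong)
    fix i j assume ij: "i < a" "j < a"
    have "(\<Sum>k<a. H i k * real (j choose k)) = (\<Sum>k\<le>j. H i k * real (j choose k))"
      using ij by (intro sum.mono_neutral_right) (auto simp: binomial_eq_0)
    \<comment> \<open>Reversing the summation brings the sum into the form of
      \<open>gbinomial_add_nat\<close>.\<close>
    also have "\<dots> = (\<Sum>k\<le>j. real (j choose (j - k)) * H i (j - k))"
      by (subst sum.nat_diff_reindex[of _ "Suc j", unfolded lessThan_Suc_atMost, symmetric])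
         (simp add: mult.commute)
    also have "\<dots> = (\<Sum>k\<le>j. real (j choose k) * (if i + k \<le> b + j then z gchoose (b + j - (i + k)) else 0))"
    proof (intro sum.cong refl)
      fix k assume "k \<in> {..j}"
      then have k: "k \<le> j" by simp
      then have "i \<le> b + (j - k) \<longleftrightarrow> i + k \<le> b + j" "b + (j - k) - i = b + j - (i + k)" by auto
      then show "real (j choose (j - k)) * H i (j - k) =
        real (j choose k) * (if i + k \<le> b + j then z gchoose (b + j - (i + k)) else 0)"
        using binomial_symmetric[OF k] by (simp only: H_def)
    qed
    finally have eq: "(\<Sum>k<a. H i k * real (j choose k)) = \<dots>" .
    show "(\<Sum>k<a. H i k * real (j choose k)) = inverse (P i) * fact i * (P (b + j) / fact (b + j)
      * (real (b + j) gchoose i))"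
    proof (cases "i \<le> b + j")
      case True
      let ?n = "b + j - i"
      have "(\<Sum>k<a. H i k * real (j choose k)) = (z + real j) gchoose ?n"
        unfolding eq gbinomial_add_nat using True by (intro sum.cong) auto
      also have "\<dots> = pochhammer (z - real b + 1 + real i) ?n / fact ?n"
        unfolding gbinomial_pochhammer' using True by (simp add: of_nat_diff algebra_simps)
      also have "pochhammer (z - real b + 1 + real i) ?n = P (b + j) / P i"
        using pochhammer_product[OF True, of "z - real b + 1"] P_pos[of i] by (simp add: P_def)
      also have "P (b + j) / P i / fact ?n = P (b + j) / P i * (1 / fact ?n)" by simp
      also have "1 / fact ?n = fact i / fact (b + j) * (real (b + j) gchoose i)"
        unfolding binomial_gbinomial[symmetric] using True by (simp add: binomial_fact)
      also have "P (b + j) / P i * \<dots> = inverse (P i) * fact i * (P (b + j) / fact (b + j)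
          * (real (b + j) gchoose i))"
        by (simp add: divide_inverse)
      finally show ?thesis .
    next
      case False
      then have "(\<Sum>k<a. H i k * real (j choose k)) = 0"
        unfolding eq by (intro sum.neutral) auto
      moreover have "real (b + j) gchoose i = 0"
        unfolding binomial_gbinomial[symmetric] using False by (simp add: binomial_eq_0)
      ultimately show ?thesis by simp
    qed
  qed
  also have "\<dots> = (\<Prod>i<a. inverse (P i) * fact i) * ((\<Prod>j<a. P (b + j) / fact (b + j))
      * fdet a (\<lambda>i j. real (b + j) gchoose i))"
    unfolding fdet_scale_rows fdet_scale_cols ..
  also have "fdet a (\<lambda>i j. real (b + j) gchoose i) = 1"
    using fdet_transpose[of a "\<lambda>i j. real (b + i) gchoose j"]
      fdet_gbinomial_consecutive[of a "real b"] by simp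
  also have "(\<Prod>i<a. inverse (P i) * fact i) * ((\<Prod>j<a. P (b + j) / fact (b + j)) * 1)
    = (\<Prod>j<a. (\<Prod>t<b. z - real b + 1 + real j + real t) * fact j / fact (b + j))"
    unfolding mult_1_right prod.distrib[symmetric]
  proof (intro prod.cong refl)
    fix j
    have "P (b + j) = P j * (\<Prod>t<b. z - real b + 1 + real j + real t)"
      using pochhammer_product'[of "z - real b + 1" j b]
      by (simp add: P_def add.commute[of b j] pochhammer_prod atLeast0LessThan)
    then show "inverse (P j) * fact j * (P (b + j) / fact (b + j)) =
      (\<Prod>t<b. z - real b + 1 + real j + real t) * fact j / fact (b + j)"
      using P_pos[of j] by (simp add: field_simps)
  qed
  finally show ?thesis by (simp only: H_def[abs_def])
qed

section \<open>Vandermonde products of complementary sets\<close>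

text \<open>The Vandermonde product of a set; the default 1 avoids a sorted enumeration.\<close>

definition vdm :: "nat set \<Rightarrow> real" where
  "vdm A = (\<Prod>y\<in>A. \<Prod>x\<in>A. if x < y then real y - real x else 1)"

lemma vdm_insert:
  assumes "finite A" "y \<notin> A"
  shows "vdm (insert y A) = vdm A * (\<Prod>x\<in>A. \<bar>real x - real y\<bar>)"
proof -
  let ?w = "\<lambda>x y. if x < y then real y - real x else 1"
  have "vdm (insert y A) = vdm A * ((\<Prod>x\<in>A. ?w x y) * (\<Prod>x\<in>A. ?w y x))"
    using assms by (simp add: vdm_def prod.distrib algebra_simps)
  also have "(\<Prod>x\<in>A. ?w x y) * (\<Prod>x\<in>A. ?w y x) = (\<Prod>x\<in>A. \<bar>real x - real y\<bar>)"
    unfolding prod.distrib[symmetric] using assms by (intro prod.cong) auto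
  finally show ?thesis .
qed

lemma prod_diff_lessThan: "(\<Prod>u<y. real y - real u) = fact y"
proof -
  have "(\<Prod>u<y. real y - real u) = (\<Prod>u<y. real (y - u))"
    by (intro prod.cong) (auto simp: of_nat_diff)
  then show ?thesis by (simp add: fact_prod_rev atLeast0LessThan)
qed

lemma prod_abs_diff_all:
  assumes "y < K"
  shows "(\<Prod>u\<in>{..<K} - {y}. \<bar>real u - real y\<bar>) = fact y * fact (K - 1 - y)"
proof -
  have eq: "{..<K} - {y} = {..<y} \<union> {y<..<K}" using assms by auto
  have "(\<Prod>u\<in>{..<K} - {y}. \<bar>real u - real y\<bar>)
      = (\<Prod>u<y. \<bar>real u - real y\<bar>) * (\<Prod>u\<in>{y<..<K}. \<bar>real u - real y\<bar>)"
    unfolding eq by (rule prod.union_disjoint) auto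
  also have "(\<Prod>u\<in>{y<..<K}. \<bar>real u - real y\<bar>) = (\<Prod>t<K - 1 - y. real (Suc t))"
    by (rule prod.reindex_bij_witness[of _ "\<lambda>t. Suc (y + t)" "\<lambda>u. u - y - 1"])
       (use assms in \<open>auto simp: of_nat_diff\<close>)
  finally show ?thesis
    by (simp add: prod_diff_lessThan fact_prod_Suc atLeast0LessThan)
qed

lemma vdm_lessThan: "vdm {..<K} = (\<Prod>l<K. fact l)"
proof (induction K)
  case 0
  show ?case by (simp add: vdm_def)
next
  case (Suc K)
  then show ?case by (simp add: lessThan_Suc vdm_insert prod_diff_lessThan mult.commute)
qed

text \<open>Complementary beta-sets describe conjugate partitions, and for either of them the product of
  differences divided by the product of factorials is the reciprocal of the hook product.\<close>
lemma vdm_complement: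
  assumes "finite Y" "Y \<subseteq> {..<K}"
  shows "vdm ({..<K} - Y) * (\<Prod>y\<in>Y. fact (K - 1 - y)) = vdm Y * (\<Prod>l\<in>{..<K} - Y. fact l)"
  using assms
proof (induction Y rule: finite_induct)
  case empty
  then show ?case using vdm_lessThan[of K] by (simp add: vdm_def)
next
  case (insert y Y)
  let ?L = "{..<K} - Y" and ?L' = "{..<K} - insert y Y"
  let ?p1 = "\<Prod>x\<in>?L'. \<bar>real x - real y\<bar>" and ?p2 = "\<Prod>x\<in>Y. \<bar>real x - real y\<bar>"
  have y: "y < K" "?L = insert y ?L'" "y \<notin> ?L'" using insert by auto
  have L: "vdm ?L = vdm ?L' * ?p1" "(\<Prod>l\<in>?L. fact l) = (fact y * (\<Prod>l\<in>?L'. fact l) :: real)"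
    unfolding y(2) using vdm_insert[of ?L' y] y(3) by simp_all
  have eq: "{..<K} - {y} = ?L' \<union> Y" using insert by auto
  \<comment> \<open>Moving \<open>y\<close> from the complement to \<open>Y\<close> removes
    \<open>?p1\<close> from one Vandermonde product and adds \<open>?p2\<close> to the other;
    \<open>?p1 * ?p2\<close> accounts for both factorials that change.\<close>
  have "(\<Prod>u\<in>{..<K} - {y}. \<bar>real u - real y\<bar>) = ?p1 * ?p2"
    unfolding eq using insert by (intro prod.union_disjoint) auto
  then have p: "?p1 * ?p2 = fact y * fact (K - 1 - y)" using prod_abs_diff_all[OF y(1)] by simp
  have "vdm ?L * (\<Prod>y\<in>Y. fact (K - 1 - y)) = vdm Y * (\<Prod>l\<in>?L. fact l)"
    using insert by blast
  then have "vdm ?L' * ?p1 * (\<Prod>y\<in>Y. fact (K - 1 - y)) * ?p2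
      = vdm Y * (fact y * (\<Prod>l\<in>?L'. fact l)) * ?p2"
    unfolding L by simp
  then have "vdm ?L' * (?p1 * ?p2) * (\<Prod>y\<in>Y. fact (K - 1 - y))
      = fact y * (vdm Y * ?p2 * (\<Prod>l\<in>?L'. fact l))"
    by (simp only: ac_simps)
  then have "vdm ?L' * (fact (K - 1 - y) * (\<Prod>y\<in>Y. fact (K - 1 - y)))
      = vdm Y * ?p2 * (\<Prod>l\<in>?L'. fact l)"
    unfolding p by simp
  then show ?case using insert by (simp add: vdm_insert)
qed

lemma vdm_strict_mono_image:
  fixes l :: "nat \<Rightarrow> nat"
  assumes "strict_mono_on {..<M} l"
  shows "vdm (l ` {..<M}) = (\<Prod>i<M. \<Prod>t<i. real (l i) - real (l t))"
proof -
  have inj: "inj_on l {..<M}" using assms by (rule strict_mono_on_imp_inj_on)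
  have "vdm (l ` {..<M}) = (\<Prod>i<M. \<Prod>t<M. if l t < l i then real (l i) - real (l t) else 1)"
    using inj by (simp add: vdm_def prod.reindex)
  also have "\<dots> = (\<Prod>i<M. \<Prod>t<i. real (l i) - real (l t))"
  proof (rule prod.cong[OF refl])
    fix i assume i: "i \<in> {..<M}"
    show "(\<Prod>t<M. if l t < l i then real (l i) - real (l t) else 1) = (\<Prod>t<i. real (l i) - real (l t))"
    proof (rule prod.mono_neutral_cong_right)
      show "\<forall>t\<in>{..<M} - {..<i}. (if l t < l i then real (l i) - real (l t) else 1) = 1"
      proof
        fix t assume t: "t \<in> {..<M} - {..<i}"
        then have "l i \<le> l t"
          using i strict_mono_onD[OF assms, of i t] by (cases "i = t") auto
        then show "(if l t < l i then real (l i) - real (l t) else 1) = 1" by simp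
      qed
    next
      fix t assume "t \<in> {..<i}"
      then show "(if l t < l i then real (l i) - real (l t) else 1) = real (l i) - real (l t)"
        using i strict_mono_onD[OF assms, of t i] by auto
    qed (use i in auto)
  qed
  finally show ?thesis .
qed

lemma vdm_progression:
  assumes "r > 0"
  shows "vdm ((\<lambda>t. r * t) ` {..<q}) = (\<Prod>j<q. real r ^ j * fact j)"
proof -
  have "strict_mono_on {..<q} (\<lambda>t. r * t)" using assms by (auto simp: strict_mono_on_def)
  then have "vdm ((\<lambda>t. r * t) ` {..<q}) = (\<Prod>j<q. \<Prod>t<j. real (r * j) - real (r * t))"
    by (rule vdm_strict_mono_image)
  also have "\<dots> = (\<Prod>j<q. \<Prod>t<j. real r * (real j - real t))"
    by (intro prod.cong refl) (auto simp: algebra_simps)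
  finally show ?thesis by (simp only: prod.distrib prod_constant card_lessThan prod_diff_lessThan)
qed

section \<open>The shape in terms of beta-numbers\<close>

text \<open>Row \<open>i\<close>, counted from the bottom and from 0, of the columns of lengths
  \<open>e + (q - 1) m, \<dots>, e + m, e\<close> attached below the rectangle.\<close>
definition leg_row :: "nat \<Rightarrow> nat \<Rightarrow> nat \<Rightarrow> nat" where
  "leg_row q m i = card {t. t < q \<and> t * m \<le> i}"

text \<open>The set counted by \<open>leg_row\<close> is an initial segment of the naturals, so its
  cardinality is a threshold.\<close>

lemma less_leg_row_iff: "k < leg_row q m i \<longleftrightarrow> k < q \<and> k * m \<le> i"
proof
  assume "k < leg_row q m i"
  show "k < q \<and> k * m \<le> i"
  proof (rule ccontr)
    assume *: "\<not> ?thesis"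
    have "{t. t < q \<and> t * m \<le> i} \<subseteq> {..<k}"
    proof (rule subsetI, rule ccontr)
      fix t assume t: "t \<in> {t. t < q \<and> t * m \<le> i}" "t \<notin> {..<k}"
      then have "k * m \<le> t * m" by (intro mult_le_mono1) auto
      with t * show False by auto
    qed
    from card_mono[OF _ this] \<open>k < leg_row q m i\<close> show False by (simp add: leg_row_def)
  qed
next
  assume *: "k < q \<and> k * m \<le> i"
  have "{..<Suc k} \<subseteq> {t. t < q \<and> t * m \<le> i}"
  proof
    fix t assume t: "t \<in> {..<Suc k}"
    then have "t * m \<le> k * m" by (intro mult_le_mono1) auto
    with * have "t * m \<le> i" by linarith
    with t * show "t \<in> {t. t < q \<and> t * m \<le> i}" by simp
  qed
  from card_mono[OF _ this] show "k < leg_row q m i" by (simp add: leg_row_def)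
qed

lemma leg_row_le: "leg_row q m i \<le> q"
  using less_leg_row_iff[of q q m i] by simp

lemma leg_row_mono: "i \<le> i' \<Longrightarrow> leg_row q m i \<le> leg_row q m i'"
  unfolding leg_row_def by (intro card_mono) auto

text \<open>The beta-numbers of the leg avoid the multiples \<open>(m + 1) * t\<close> with
  \<open>t < q\<close>: if \<open>t * m \<le> i\<close>, then \<open>leg_row q m i > t\<close> and
  the sum is too large, otherwise it is too small. Counting shows that nothing else below
  \<open>M + q\<close> is missed.\<close>

lemma leg_row_partition:
  assumes M: "M = e + (q - 1) * m"
  shows "(\<lambda>i. leg_row q m i + i) ` {..<M} \<union> (\<lambda>t. (m + 1) * t) ` {..<q} = {..<M + q}"
    (is "?A \<union> ?B = _")
    and "strict_mono_on {..<M} (\<lambda>i. leg_row q m i + i)"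
    and "(\<lambda>i. leg_row q m i + i) ` {..<M} \<inter> (\<lambda>t. (m + 1) * t) ` {..<q} = {}"
proof -
  show mono: "strict_mono_on {..<M} (\<lambda>i. leg_row q m i + i)"
    using leg_row_mono by (intro strict_mono_onI) (simp add: add_le_less_mono)
  have ne: "leg_row q m i + i \<noteq> (m + 1) * t" if "t < q" for i t
  proof (cases "t * m \<le> i")
    case True
    then have "t < leg_row q m i" using that by (simp add: less_leg_row_iff)
    then show ?thesis using True by (simp add: algebra_simps)
  next
    case False
    then have "\<not> t < leg_row q m i" by (simp add: less_leg_row_iff)
    then show ?thesis using False by (simp add: algebra_simps)
  qed
  then show disj: "?A \<inter> ?B = {}" by auto
  have "?A \<subseteq> {..<M + q}"
    using leg_row_le by (auto simp: add.commute[of M] intro!: add_le_less_mono)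
  moreover have "?B \<subseteq> {..<M + q}"
  proof clarsimp
    fix t assume "t < q"
    then have "t * m \<le> (q - 1) * m" by (intro mult_le_mono1) auto
    then show "t + m * t < M + q" using \<open>t < q\<close> unfolding M mult.commute[of m] by linarith
  qed
  moreover have "card (?A \<union> ?B) = card ?A + card ?B" using disj by (intro card_Un_disjoint) auto
  moreover have "card ?A = M"
    using card_image[OF strict_mono_on_imp_inj_on[OF mono]] by simp
  moreover have "card ?B = q" 
    using mult_cancel1[of "m + 1"] by (subst card_image) (auto simp: inj_on_def simp del: mult_Suc)
  ultimately show "?A \<union> ?B = {..<M + q}" by (intro card_subset_eq) auto
qed

text \<open>From the bottom come the \<open>M\<close> rows of the leg, then \<open>c\<close> full
  long rows, then the \<open>a\<close> long rows without their first \<open>b\<close> cells. For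
  \<open>b + c = 0\<close> the \<open>M = e\<close> lowest rows are empty.\<close>

lemma Lambda_shape_eq_skew_cells:
  assumes M: "M = e + (b + c - 1) * m"
    and lam: "\<And>i. lam i = (if i < M then leg_row (b + c) m i else b + c + d + (i - M) * m)"
    and mu: "\<And>i. mu i = (if i < M + c then 0 else b)"
  shows "Lambda_shape a b c d e m = skew_cells (M + (c + a)) lam mu"
proof -
  let ?N = "M + (c + a)"
  have row: "(?N - i, j) \<in> Lambda_shape a b c d e m \<longleftrightarrow> (?N - i, j) \<in> skew_cells ?N lam mu"
    if i: "i < ?N" for i j
  proof (cases "i < M")
    case True
    have "j \<le> b + c \<and> ?N - i \<le> a + c + theta b c e m j \<longleftrightarrow> j \<le> leg_row (b + c) m i" if j: "j \<ge> 1"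
    proof -
      obtain k where k: "j = Suc k" using j by (cases j) auto
      \<comment> \<open>Column \<open>Suc k\<close> of the leg has length \<open>M - k * m\<close>,
        so it contains row \<open>i\<close> from the bottom exactly when
        \<open>k * m \<le> i\<close>.\<close>
      have "(b + c - 1) * m = (b + c - j) * m + k * m" if "j \<le> b + c"
        using that unfolding k by (simp flip: add_mult_distrib)
      then have "j \<le> b + c \<Longrightarrow> ?N - i \<le> a + c + theta b c e m j \<longleftrightarrow> k * m \<le> i"
        using True by (simp add: theta_def M, linarith)
      then show ?thesis using less_leg_row_iff[of k "b + c" m i] by (auto simp: k Suc_le_eq)
    qed
    then show ?thesis
      using i True
      by (auto simp: skew_cells_iff lam mu Lambda_shape_def outer_shape_def rect_shape_def)
  next
    case False
    have "a + c - (?N - i) = i - M" using i False by simp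
    then have "nu a c d m (?N - i) = d + (i - M) * m" by (simp add: nu_def)
    then show ?thesis
      using i False
      by (auto simp: skew_cells_iff lam mu Lambda_shape_def outer_shape_def rect_shape_def)
  qed
  have "\<exists>i<?N. x = ?N - i" if "(x, j) \<in> Lambda_shape a b c d e m" for x j
  proof -
    have x: "1 \<le> x" "1 \<le> j" "x \<le> a + c \<or> j \<le> b + c \<and> x \<le> a + c + theta b c e m j"
      using that by (auto simp: Lambda_shape_def outer_shape_def)
    have "(b + c - j) * m \<le> (b + c - 1) * m" using x by (intro mult_le_mono1) auto
    then have "x \<le> ?N" using x(3) unfolding theta_def M by linarith
    then show ?thesis using x(1) by (intro exI[of _ "?N - x"]) auto
  qed
  then show ?thesis
  proof (intro equalityI subsetI, goal_cases)
    case (1 p)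
    then obtain x j i where "p = (x, j)" "i < ?N" "x = ?N - i" by (cases p) blast
    then show ?case using 1 row by blast
  next
    case (2 p)
    then obtain i j where "p = (?N - i, j)" "i < ?N" by (auto simp: skew_cells_def)
    then show ?case using 2 row by blast
  qed
qed

section \<open>Superfactorials and the product formula\<close>

lemma superfact_eq: "real (superfact n) = (\<Prod>k<n. fact k)"
proof -
  have "superfact n = (\<Prod>k<n. fact k)"
    unfolding superfact_def by (rule prod.mono_neutral_left) (auto simp: not_less_eq_eq)
  then show ?thesis by simp
qed

lemma superfact_add: "real (superfact (k + n)) = real (superfact k) * (\<Prod>j<n. fact (k + j))"
  by (simp add: superfact_eq prod_lessThan_add)

text \<open>Between two consecutive multiples of \<open>m + 1\<close> the factorial gains the upper
  multiple itself and the \<open>m\<close> numbers strictly between them.\<close>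

lemma fact_step_falling_fact:
  "fact (Suc j * (m + 1)) = fact (j * (m + 1)) * (Suc j * (m + 1)) * falling_fact (Suc j * m + Suc j - 1) m"
proof -
  let ?k = "Suc j * (m + 1)"
  have "falling_fact (?k - 1) m * fact (?k - 1 - m) = fact (?k - 1)"
  proof -
    have "falling_fact (k + m) m * fact k = fact (k + m)" for k
    proof (induction m)
      case (Suc m)
      have "falling_fact (k + Suc m) (Suc m) = Suc (k + m) * falling_fact (k + m) m"
        unfolding falling_fact_def prod.lessThan_Suc_shift by simp
      then have "falling_fact (k + Suc m) (Suc m) * fact k = Suc (k + m) * (falling_fact (k + m) m * fact k)"
        by (simp only: mult.assoc)
      then show ?case unfolding Suc by simp
    qed (simp add: falling_fact_def)
    from this[of "j * (m + 1)"] show ?thesis by (simp add: algebra_simps)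
  qed
  moreover have "?k - 1 - m = j * (m + 1)" "Suc j * m + Suc j - 1 = ?k - 1" by simp_all
  moreover have "fact ?k = ?k * fact (?k - 1)" by (simp add: fact_reduce)
  ultimately show ?thesis by (simp only: mult_ac)
qed

text \<open>This is the source of \<open>Psi\<close>: iterating the preceding step splits each
  factorial into a power of \<open>m + 1\<close>, a factorial and falling factorials.\<close>

lemma prod_fact_multiples:
  "(\<Prod>i<n. fact (i * (m + 1))) = (\<Prod>i<n. real (m + 1) ^ i) * real (superfact n) * real (Psi m n)"
proof -
  have 1: "(fact (i * (m + 1)) :: nat) = (m + 1) ^ i * fact i * (\<Prod>j\<in>{1..i}. falling_fact (j * m + j - 1) m)" for i
  proof (induction i)
    case (Suc i)
    have "(\<Prod>j\<in>{1..Suc i}. falling_fact (j * m + j - 1) m)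
      = (\<Prod>j\<in>{1..i}. falling_fact (j * m + j - 1) m) * falling_fact (Suc i * m + Suc i - 1) m"
      by simp
    then show ?case
      unfolding fact_step_falling_fact Suc by (simp only: power_Suc fact_Suc of_nat_id mult_ac)
  qed simp
  have "Psi m n = (\<Prod>i<n. \<Prod>j\<in>{1..i}. falling_fact (j * m + j - 1) m)"
    unfolding Psi_def by (rule prod.mono_neutral_left) (auto simp: not_less_eq_eq)
  moreover have "(\<Prod>i<n. fact (i * (m + 1))) = real (\<Prod>i<n. fact (i * (m + 1)))" by simp
  ultimately show ?thesis
    unfolding 1 superfact_eq by (simp add: prod.distrib)
qed


theorem theorem4p1:
  fixes a b c d e m n :: nat and \<pi> :: "cell set"
  assumes "\<pi> = Lambda_shape a b c d e m"
    and "n = card \<pi>"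
  shows "real (num_syt \<pi>) =
    fact n
    * (real (superfact (a + b + c) * superfact a * superfact b * superfact c)
       / real (superfact (a + b) * superfact (b + c) * superfact (a + c)
               * Psi m (a + c) * Psi m (b + c)))
    * (\<Prod>i<a + c. fact (i * (m + 1)) / fact (d + i * (m + 1)))
    * (\<Prod>i<b + c. fact (i * (m + 1)) / fact (e + i * (m + 1)))
    * (real (\<Prod>i<b. \<Prod>j<a. 1 + d + e + (c + i + j) * (m + 1))
       / real (\<Prod>i<b + c. \<Prod>j<a + c. 1 + d + e + (i + j) * (m + 1)))"
proof -
  define r where "r = m + 1"
  define q where "q = b + c"
  define M where "M = e + (q - 1) * m"
  define K where "K = M + b + c"
  define N where "N = M + (c + a)"
  define l where "l i = leg_row q m i + i" for i
  define x where "x i = K + d + i * r" for i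
  define lam where "lam i = (if i < M then leg_row (b + c) m i else b + c + d + (i - M) * m)" for i
  define mu where "mu i = (if i < M + c then 0 else b)" for i
  define s where "s j = (if j < c then j else b + j)" for j
  define z where "z = real (K + d) / real r"
  define R where "R k = (\<Prod>j<k. real r ^ j)" for k
  define E where "E = (\<Prod>i<q. fact (e + i * r) :: real)"
  define D where "D = (\<Prod>i<c + a. fact (d + i * r) :: real)"
  define den where "den = (\<Prod>i<c + a. \<Prod>t<q. real (1 + d + e + (t + i) * r))"
  define num where "num = (\<Prod>j<a. \<Prod>t<b. real (1 + d + e + (c + t + j) * r))"
  note Kq = K_def[unfolded add.assoc, folded q_def]
  have r: "r > 0" "real r > 0" by (simp_all add: r_def)
  \<comment> \<open>So \<open>K - 1\<close> exceeds the largest progression element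
    \<open>(q - 1) * r\<close> by exactly \<open>e\<close>, and \<open>y \<mapsto> K - 1 - y\<close>
    reflects the progression to \<open>e, e + r, ...\<close>. For \<open>q = 0\<close> the truncated
    \<open>q - 1\<close> would break this.\<close>
  have K1: "K = 1 + e + (q - 1) * r" if "q > 0"
    using that by (cases q) (simp_all add: Kq M_def r_def)
  have shape: "\<pi> = skew_cells N lam mu"
    unfolding assms(1) N_def
    by (rule Lambda_shape_eq_skew_cells) (simp_all add: M_def q_def lam_def mu_def)

  have lam_mono: "mono_on {..<N} lam"
  proof (rule mono_onI)
    fix i j assume "i \<in> {..<N}" "j \<in> {..<N}" "i \<le> j"
    moreover have "leg_row (b + c) m i \<le> b + c + (d + (j - M) * m)"
      using leg_row_le[of "b + c" m i] by linarith
    ultimately show "lam i \<le> lam j" by (auto simp: lam_def leg_row_mono add.assoc)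
  qed
  have "real (num_syt \<pi>) = fact n * fdet N (\<lambda>i j. inv_fact (int (lam i + i) - int (mu j + j)))"
    unfolding shape assms(2) using lam_mono
    by (intro num_syt_skew) (auto simp: mono_on_def mu_def lam_def)
  also have "fdet N (\<lambda>i j. inv_fact (int (lam i + i) - int (mu j + j))) =
      fdet N (\<lambda>i j. inv_fact (int (if i < M then l i else x (i - M))
        - int ((if j < M + c then 0 else b) + j)))"
  proof (rule fdet_cong)
    fix i j
    have "lam i + i = (if i < M then l i else x (i - M))"
    proof (cases "i < M")
      case False
      then obtain k where "i = M + k" by (auto simp: not_less le_iff_add)
      then show ?thesis by (simp add: lam_def x_def K_def r_def algebra_simps)
    qed (simp add: lam_def l_def q_def)
    then show "inv_fact (int (lam i + i) - int (mu j + j)) =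
        inv_fact (int (if i < M then l i else x (i - M)) - int ((if j < M + c then 0 else b) + j))"
      by (simp only: mu_def)
  qed
  also have "\<dots> = (\<Prod>i<M. \<Prod>t<i. real (l i) - real (l t)) / (\<Prod>i<M. fact (l i))
      * (\<Prod>i<c + a. 1 / (fact (x i - K) * (\<Prod>t<b + c. real (x i) - r * real t)))
      * ((\<Prod>j<c + a. real r ^ s j * fact (s j))
        * fdet (c + a) (\<lambda>i j. (real (x i) / r) gchoose s j))"
    unfolding N_def K_def s_def
  proof (rule fdet_falling_reduce[OF r(1)])
    show "l ` {..<M} \<union> (\<lambda>t. r * t) ` {..<b + c} = {..<M + b + c}"
      using leg_row_partition(1)[OF M_def] by (simp add: l_def[abs_def] r_def q_def add.assoc)
    show "inj_on l {..<M}"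
      using leg_row_partition(2)[OF M_def] unfolding l_def[abs_def]
      by (rule strict_mono_on_imp_inj_on)
  qed (simp add: x_def K_def)
  \<comment> \<open>\<open>vdm_complement\<close> trades the leg beta-numbers for the complementary
    progression, whose Vandermonde product is explicit.\<close>
  also have "(\<Prod>i<M. \<Prod>t<i. real (l i) - real (l t)) / (\<Prod>i<M. fact (l i)) = R q * superfact q / E"
  proof -
    let ?L = "l ` {..<M}" and ?Y = "(\<lambda>t. r * t) ` {..<q}"
    have mono: "strict_mono_on {..<M} l"
      using leg_row_partition(2)[OF M_def] by (simp add: l_def[abs_def])
    have un: "?L \<union> ?Y = {..<K}" and disj: "?L \<inter> ?Y = {}"
      using leg_row_partition(1,3)[OF M_def] by (simp_all add: l_def[abs_def] r_def Kq)
    then have L: "?L = {..<K} - ?Y" and Y: "?Y \<subseteq> {..<K}" by auto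
    have inj: "inj_on (\<lambda>t. r * t) {..<q}" using r by (auto simp: inj_on_def)
    have "(\<Prod>y\<in>?Y. fact (K - 1 - y)) = (\<Prod>t<q. fact (K - 1 - r * t) :: real)"
      using inj by (simp add: prod.reindex)
    also have "\<dots> = (\<Prod>t<q. fact (e + (q - Suc t) * r))"
    proof (rule prod.cong[OF refl])
      fix t assume "t \<in> {..<q}"
      then obtain u where u: "q = Suc t + u" by (auto simp: less_iff_Suc_add)
      then have "K - 1 - r * t = e + (q - Suc t) * r" using K1 by (simp add: algebra_simps)
      then show "(fact (K - 1 - r * t) :: real) = fact (e + (q - Suc t) * r)" by simp
    qed
    also have "\<dots> = E" unfolding E_def by (rule prod.nat_diff_reindex)
    finally have "vdm ?L * E = vdm ?Y * (\<Prod>l\<in>?L. fact l)"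
      using vdm_complement[OF _ Y] unfolding L by simp
    moreover have "vdm ?Y = R q * superfact q"
      unfolding vdm_progression[OF r(1)] by (simp add: R_def superfact_eq prod.distrib)
    moreover have "(\<Prod>l\<in>?L. fact l) = (\<Prod>i<M. fact (l i) :: real)"
      using strict_mono_on_imp_inj_on[OF mono] by (simp add: prod.reindex)
    moreover have "E > 0" "(\<Prod>i<M. fact (l i) :: real) > 0" by (auto simp: E_def intro!: prod_pos)
    ultimately show ?thesis
      unfolding vdm_strict_mono_image[OF mono, symmetric] by (simp add: field_simps)
  qed
  also have "(\<Prod>i<c + a. 1 / (fact (x i - K) * (\<Prod>t<b + c. real (x i) - r * real t))) = 1 / (D * den)"
  proof -
    have "(\<Prod>t<b + c. real (x i) - r * real t) = (\<Prod>t<q. real (1 + d + e + (t + i) * r))" for i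
    proof -
      have "(\<Prod>t<b + c. real (x i) - r * real t) = (\<Prod>t<q. real (1 + d + e + ((q - Suc t) + i) * r))"
        unfolding q_def[symmetric]
      proof (rule prod.cong[OF refl])
        fix t assume "t \<in> {..<q}"
        then obtain u where u: "q = Suc t + u" by (auto simp: less_iff_Suc_add)
        then have "x i = 1 + d + e + ((q - Suc t) + i) * r + r * t"
          using K1 by (simp add: x_def algebra_simps)
        then show "real (x i) - r * real t = real (1 + d + e + ((q - Suc t) + i) * r)" by simp
      qed
      also have "\<dots> = (\<Prod>t<q. real (1 + d + e + (t + i) * r))" by (rule prod.nat_diff_reindex)
      finally show ?thesis .
    qed
    moreover have "x i - K = d + i * r" for i by (simp add: x_def)
    ultimately show ?thesis by (simp only: prod_dividef prod.distrib D_def den_def) simp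
  qed
  also have "(\<Prod>j<c + a. real r ^ s j * fact (s j))
      * fdet (c + a) (\<lambda>i j. (real (x i) / r) gchoose s j)
    = R (c + a) * num * (real (superfact c) * (\<Prod>j<a. fact (q + j))) * (superfact a / (\<Prod>j<a. fact (b + j)))"
  proof -
    have rz: "r * z = K + d" using r by (simp add: z_def)
    have xz: "real (x i) / r = z + real i" for i
      using r by (simp add: x_def z_def add_divide_distrib)
    \<comment> \<open>Since \<open>r * z = K + d = 1 + d + e + (b - 1 + c) * r\<close>, scaling a
      factor of the Toeplitz product by \<open>r\<close> gives a numerator factor of the
      claim.\<close>
    have zb: "r * (z - real b + 1 + real j + real t) = real (1 + d + e + (c + t + j) * r)"
      if t: "t < b" for j t
    proof -
      obtain b' where b': "b = Suc b'" using t by (cases b) auto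
      then have K: "K = 1 + e + (b' + c) * r" using K1 by (simp add: q_def)
      have "r * (z - real b + 1 + real j + real t) = r * z + r * (real j + real t) - r * real b'"
        by (simp add: b' algebra_simps)
      then show ?thesis unfolding rz K by (simp add: algebra_simps)
    qed
    \<comment> \<open>For \<open>b > 0\<close> this is positivity of the scaled factor with both
      indices 0; for \<open>b = 0\<close> that factor is absent, and \<open>z \<ge> 0\<close>
      suffices.\<close>
    have "z > real b - 1"
    proof (cases "b > 0")
      case True
      have "r * (z - real b + 1 + real 0 + real 0) > 0"
        unfolding zb[OF True] by (simp only: of_nat_0_less_iff)
      then show ?thesis using r by (simp add: zero_less_mult_iff)
    next
      case False
      moreover have "z \<ge> 0" by (simp add: z_def)
      ultimately show ?thesis by simp
    qed
    then have "fdet (c + a) (\<lambda>i j. (real (x i) / r) gchoose s j)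
        = (\<Prod>j<a. (\<Prod>t<b. z - real b + 1 + real j + real t) * fact j / fact (b + j))"
      unfolding xz s_def by (simp only: fdet_gbinomial_gap fdet_gbinomial_toeplitz)
    also have "\<dots> = (\<Prod>j<a. \<Prod>t<b. z - real b + 1 + real j + real t)
        * (superfact a / (\<Prod>j<a. fact (b + j)))"
      by (simp add: prod_dividef prod.distrib superfact_eq)
    finally have det: "fdet (c + a) (\<lambda>i j. (real (x i) / r) gchoose s j) = \<dots>" .
    have num: "(\<Prod>j<a. real r ^ b) * (\<Prod>j<a. \<Prod>t<b. z - real b + 1 + real j + real t) = num"
    proof -
      have "real r ^ b * (\<Prod>t<b. z - real b + 1 + real j + real t)
          = (\<Prod>t<b. real (1 + d + e + (c + t + j) * r))" for j
      proof -
        have "real r ^ b * (\<Prod>t<b. z - real b + 1 + real j + real t)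
            = (\<Prod>t<b. real r * (z - real b + 1 + real j + real t))"
          by (simp only: prod.distrib prod_constant card_lessThan)
        also have "\<dots> = (\<Prod>t<b. real (1 + d + e + (c + t + j) * r))"
          by (intro prod.cong refl zb) simp
        finally show ?thesis .
      qed
      then show ?thesis unfolding num_def prod.distrib[symmetric] by (intro prod.cong refl)
    qed
    \<comment> \<open>Past the gap the exponent is \<open>b + (c + j)\<close>: the part
      \<open>r ^ b\<close> scales the \<open>b\<close> factors of the Toeplitz product, and the rest
      completes \<open>R (c + a)\<close>.\<close>
    have "(\<Prod>j<c + a. real r ^ s j * fact (s j))
        = (\<Prod>j<c. real r ^ j * fact j) * (\<Prod>j<a. real r ^ b * real r ^ (c + j) * fact (q + j))"
      unfolding prod_lessThan_add by (simp add: s_def q_def power_add add.assoc)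
    also have "\<dots> = R (c + a) * (\<Prod>j<a. real r ^ b) * (real (superfact c) * (\<Prod>j<a. fact (q + j)))"
      unfolding R_def prod_lessThan_add superfact_eq prod.distrib by (simp only: mult_ac)
    finally show ?thesis unfolding det num[symmetric] by (simp only: mult_ac)
  qed
  finally have main: "real (num_syt \<pi>) = fact n * (R q * superfact q / E * (1 / (D * den))
    * (R (c + a) * num * (real (superfact c) * (\<Prod>j<a. fact (q + j))) * (superfact a / (\<Prod>j<a. fact (b + j)))))"
    by (simp only: mult.assoc)
  have multiples: "(\<Prod>i<k. fact (i * (m + 1))) = R k * real (superfact k) * real (Psi m k)" for k
    unfolding R_def r_def by (rule prod_fact_multiples)
  have sf: "real (superfact (a + b + c)) = real (superfact q) * (\<Prod>j<a. fact (q + j))"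
    "real (superfact (a + b)) = real (superfact b) * (\<Prod>j<a. fact (b + j))"
    using superfact_add[of q a] superfact_add[of b a] by (simp_all add: q_def add_ac)
  have num: "real (\<Prod>i<b. \<Prod>j<a. 1 + d + e + (c + i + j) * (m + 1)) = num"
    unfolding num_def r_def of_nat_prod by (rule prod.swap)
  have den: "real (\<Prod>i<b + c. \<Prod>j<a + c. 1 + d + e + (i + j) * (m + 1)) = den"
    unfolding den_def r_def q_def of_nat_prod add.commute[of a c] by (rule prod.swap)
  have rhs: "(\<Prod>i<a + c. fact (i * (m + 1)) / fact (d + i * (m + 1))) = R (c + a) * real (superfact (c + a)) * real (Psi m (c + a)) / D"
    "(\<Prod>i<b + c. fact (i * (m + 1)) / fact (e + i * (m + 1))) = R q * real (superfact q) * real (Psi m q) / E"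
    unfolding prod_dividef multiples D_def E_def r_def q_def by (simp_all only: add.commute[of a c])
  have sf_pos: "real (superfact k) > 0" for k by (auto simp: superfact_eq intro!: prod_pos)
  \<comment> \<open>\<open>Psi\<close> divides a product of factorials, which is nonzero.\<close>
  have Psi_pos: "real (Psi m k) \<noteq> 0" for k
  proof
    assume "real (Psi m k) = 0"
    then have "(\<Prod>i<k. fact (i * (m + 1)) :: real) = 0" unfolding prod_fact_multiples by simp
    then show False by simp
  qed
  \<comment> \<open>The final identity with every product replaced by a real variable;
    \<open>Sb\<close> enters only because the superfactorial of \<open>a + b\<close> is that of
    \<open>b\<close> times \<open>B\<close>.\<close>
  have cancel: "f * (Rq * Sq / E' * (1 / (D' * den')) * (Rp * num' * (Sc * Q) * (Sa / B)))
    = f * (Sq * Q * Sa * Sb * Sc / (Sb * B * Sq * Sp * Pp * Pq)) * (Rp * Sp * Pp / D') * (Rq * Sq * Pq / E') * (num' / den')"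
    if "Sq \<noteq> 0" "Sp \<noteq> 0" "Sb \<noteq> 0" "Pp \<noteq> 0" "Pq \<noteq> 0"
    for f Rq Sq E' D' den' Rp num' Sc Q Sa B Sb Sp Pp Pq :: real
    using that by (simp, simp only: mult_ac)
  show ?thesis
    unfolding main rhs num den
    unfolding of_nat_mult sf q_def[symmetric] add.commute[of a c]
    using sf_pos Psi_pos by (intro cancel) (auto simp: less_imp_neq[symmetric])
qed

end
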